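(* Let $\theta>0$, let $Y=U^{1/\theta}$ where $U$ is uniformly distributed on $[0,1]$, let $Y_1,Y_2,\dots$ be i.i.d. with the distribution of $Y$, and let $X_i=Y_1\cdots Y_i$. For a realization $\mathbf{y}=(y_1,y_2,\dots)$ of $(Y_i)$ let $$\widetilde S^\theta_{\mathbf{y}}=\left\{\sum_{i=1}^\infty a_iX_i:\ a_i\in\{0,1\},\ a_ia_{i+1}=0\ \text{for all } i\ge1\right\}.$$ Let $\tau=(1+\sqrt5)/2$. Then: (a) If $\theta>1/\log\tau$, then $\mathcal{L}(\widetilde S^\theta_{\mathbf{y}})>0$ for a.e. $\mathbf{y}$. (b) If $\theta\in(0,1/\log\tau)$, then $\mathcal{L}(\widetilde S^\theta_{\mathbf{y}})=0$ and $\dim_H(\widetilde S^\theta_{\mathbf{y}})=\theta\log\tau$ for a.e. $\mathbf{y}$.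
   Context: $\mathcal{L}$ is Lebesgue measure on $\mathbb{R}$ and $\dim_H$ is Hausdorff dimension. "A.e. $\mathbf{y}$" is with respect to the law of the i.i.d. sequence $(Y_i)_{i\ge1}$; in $\widetilde S^\theta_{\mathbf{y}}$ the $X_i$ are evaluated at the realization, i.e. $X_i=y_1\cdots y_i$. *)

theory Defs
  imports "HOL-Probability.Probability"
begin

definition golden :: real where
  "golden = (1 + sqrt 5) / 2"

text \<open>
  The law of \<open>Y = U\<^sup>1\<^sup>/\<^sup>\<theta>\<close>, where \<open>U\<close> is uniform on \<open>[0, 1]\<close>. The base is nonnegative almost surely and
  \<open>0 powr a = 0\<close>, so \<open>powr\<close> agrees with the usual power there.
\<close>
definition power_uniform_law :: "real \<Rightarrow> real measure" where
  "power_uniform_law \<theta> = distr (uniform_measure lborel {0..1}) borel (\<lambda>u. u powr (1 / \<theta>))"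

text \<open>
  Sequences are indexed from 0: \<open>y i\<close> stands for the usual \<open>y\<^sub>i\<^sub>+\<^sub>1\<close>, so that \<open>partial_prods y i\<close> is
  \<open>X\<^sub>i\<^sub>+\<^sub>1 = y\<^sub>1 \<cdots> y\<^sub>i\<^sub>+\<^sub>1\<close>.
\<close>
definition partial_prods :: "(nat \<Rightarrow> real) \<Rightarrow> nat \<Rightarrow> real" where
  "partial_prods y i = (\<Prod>j\<le>i. y j)"

text \<open>
  Using \<open>sums\<close> rather than \<open>suminf\<close> keeps the unspecified value of a divergent series out of the set.
  For almost every \<open>y\<close> all these series converge.
\<close>
definition restricted_sums :: "(nat \<Rightarrow> real) \<Rightarrow> real set" where
  "restricted_sums y =
     {x. \<exists>a :: nat \<Rightarrow> real. (\<forall>i. a i \<in> {0, 1}) \<and> (\<forall>i. a i * a (Suc i) = 0) \<and>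
           (\<lambda>i. a i * partial_prods y i) sums x}"

text \<open>
  The \<open>s\<close>-th power of the diameter, with the conventions that the empty set contributes 0 for every
  \<open>s\<close> and that \<open>0\<^sup>0 = 1\<close> (whereas \<open>0 powr 0 = 0\<close>), so that the \<open>0\<close>-dimensional measure is counting
  measure. Only meant for bounded sets, since \<open>diameter\<close> is unspecified on unbounded ones.
\<close>
definition diameter_power :: "real \<Rightarrow> 'a :: metric_space set \<Rightarrow> ennreal" where
  "diameter_power s C =
     (if C = {} then 0 else if s = 0 then 1 else ennreal (diameter C powr s))"

definition hausdorff_premeasure :: "real \<Rightarrow> real \<Rightarrow> 'a :: metric_space set \<Rightarrow> ennreal" where
  "hausdorff_premeasure s \<delta> A =
     (INF C \<in> {C :: nat \<Rightarrow> 'a set. A \<subseteq> (\<Union>i. C i) \<and> (\<forall>i. bounded (C i) \<and> diameter (C i) \<le> \<delta>)}.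
        \<Sum>i. diameter_power s (C i))"

definition hausdorff_measure :: "real \<Rightarrow> 'a :: metric_space set \<Rightarrow> ennreal" where
  "hausdorff_measure s A = (SUP \<delta> \<in> {0<..}. hausdorff_premeasure s \<delta> A)"

definition hausdorff_dim :: "'a :: metric_space set \<Rightarrow> ereal" where
  "hausdorff_dim A = (INF s \<in> {s. 0 \<le> s \<and> hausdorff_measure s A = 0}. ereal s)"

end

theory Submission
  imports Defs
begin

text \<open>
  Write \<open>\<tau>\<close> for the golden ratio and \<open>X\<^sub>n\<close> for the partial products. Almost surely \<open>X\<^sub>n\<close> decays like
  \<open>exp (- n / \<theta>)\<close>, since \<open>- ln Y\<close> has mean \<open>1 / \<theta>\<close>, and there are about \<open>\<tau>\<^sup>n\<close> admissible words of length
  \<open>n\<close>. The cylinders of length \<open>n\<close> therefore cover the set by about \<open>\<tau>\<^sup>n\<close> intervals of length about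
  \<open>exp (- n / \<theta>)\<close>; this bounds its dimension by \<open>\<theta> ln \<tau>\<close> and makes it a null set when
  \<open>\<theta> ln \<tau> < 1\<close>.

  The lower bounds need a measure on the set and a second moment estimate. The greedy expansion of
  \<open>u\<close> in base \<open>\<tau>\<close> has admissible digits, and two points with the same first \<open>k\<close> digits are at distance
  at most \<open>\<tau>\<^sup>-\<^sup>k\<close> (\<open>golden_digit_agree_imp_close\<close>). So, with \<open>u\<close> uniform on \<open>[0, 1]\<close>, the
  series \<open>\<Sum> digit\<^sub>i(u) X\<^sub>i\<close> is a random point of the set whose law gives a cylinder of length \<open>k\<close> mass
  at most \<open>\<tau>\<^sup>-\<^sup>k\<close>. If the digits of \<open>u\<close> and \<open>v\<close> first differ at index \<open>k\<close>, the two points differ by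
  \<open>\<plusminus> X\<^sub>k (1 + y\<^sub>k\<^sub>+\<^sub>1 W)\<close>, where \<open>W\<close> depends only on later ratios. This is where the law of \<open>Y\<close>
  enters: the density of \<open>1 + Y w\<close> at \<open>0\<close> is \<open>\<theta> \<bar>w\<bar>\<^sup>-\<^sup>\<theta>\<close> if \<open>w \<le> - 1\<close> and
  \<open>0\<close> otherwise, so it is bounded uniformly in \<open>w\<close>
  (\<open>power_uniform_law_affine_small_ball\<close>). Hence, on the event \<open>X\<^sub>k \<ge> \<eta>\<^sup>k / C\<close>, the two points are
  \<open>r\<close>-close with probability \<open>O(r\<^sup>s \<eta>\<^sup>-\<^sup>s\<^sup>k) = O(r\<^sup>s \<bar>u - v\<bar>\<^sup>-\<^sup>\<beta>)\<close> for \<open>s \<le> 1\<close>, with \<open>\<beta> < 1\<close> as soon as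
  \<open>\<eta>\<^sup>s \<tau> > 1\<close>. One can choose such an \<open>\<eta> < exp (- 1 / \<theta>)\<close> exactly when \<open>s < \<theta> ln \<tau>\<close>.
  Integrating over \<open>u\<close> and \<open>v\<close> bounds the expected mass of the pairs at distance at most \<open>r\<close> by
  \<open>O(r\<^sup>s)\<close> (\<open>expected_correlation_bound\<close>).

  If \<open>\<theta> ln \<tau> > 1\<close>, take \<open>s = 1\<close>: by Fatou's lemma and the Cauchy-Schwarz inequality the law cannot be
  carried by few intervals of a fine grid, so the compact set has positive length
  (\<open>restricted_sums_pos_measure\<close>). If \<open>\<theta> ln \<tau> < 1\<close>, summing over dyadic \<open>r\<close> shows that the law is
  Frostman-regular of every exponent below \<open>\<theta> ln \<tau>\<close> on a set of positive mass, and the mass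
  distribution principle gives the dimension (\<open>hausdorff_measure_pos_of_correlation\<close>).
\<close>

section \<open>Greedy expansions in base golden\<close>

lemma golden_square: "golden * golden = golden + 1"
proof -
  have "sqrt 5 * sqrt 5 = (5::real)" by simp
  then show ?thesis unfolding golden_def by (simp add: field_simps)
qed

lemma golden_bounds: "1 < golden" "golden < 2"
proof -
  have "2 < sqrt (5::real)" by (rule real_less_rsqrt) simp
  moreover have "sqrt (5::real) < 3" by (rule real_less_lsqrt) auto
  ultimately show "1 < golden" "golden < 2" unfolding golden_def by auto
qed

lemma ln_golden_pos: "0 < ln golden"
  using golden_bounds by simp

text \<open>
  The greedy expansion \<open>frac u = \<Sum> d\<^sub>n / \<tau> ^ (n + 1)\<close> in base \<open>\<tau> = golden\<close>. Starting from the fractional part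
  makes every statement about the digits valid for all real \<open>u\<close>.
\<close>
primrec golden_orbit :: "nat \<Rightarrow> real \<Rightarrow> real" where
  "golden_orbit 0 u = frac u"
| "golden_orbit (Suc n) u = frac (golden * golden_orbit n u)"

definition golden_digit :: "nat \<Rightarrow> real \<Rightarrow> real" where
  "golden_digit n u = of_int \<lfloor>golden * golden_orbit n u\<rfloor>"

lemma golden_orbit_range: "0 \<le> golden_orbit n u" "golden_orbit n u < 1"
  by (cases n; simp add: frac_lt_1)+

lemma golden_orbit_step: "golden_orbit (Suc n) u = golden * golden_orbit n u - golden_digit n u"
  by (simp add: golden_digit_def frac_def)

lemma golden_digit_binary: "golden_digit n u \<in> {0, 1}"
proof -
  have "0 \<le> golden * golden_orbit n u"
    using golden_bounds golden_orbit_range[of n u] by simp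
  moreover have "golden * golden_orbit n u < 2"
  proof -
    have "golden * golden_orbit n u \<le> golden * 1"
      using golden_bounds golden_orbit_range[of n u] by (intro mult_left_mono) auto
    then show ?thesis using golden_bounds by linarith
  qed
  ultimately have "\<lfloor>golden * golden_orbit n u\<rfloor> = 0 \<or> \<lfloor>golden * golden_orbit n u\<rfloor> = 1"
    by linarith
  then show ?thesis by (auto simp: golden_digit_def)
qed

text \<open>
  After a digit 1 the remainder is below \<open>\<tau> - 1 = 1 / \<tau>\<close>, so the next digit is 0.
\<close>
lemma golden_digit_admissible: "golden_digit n u * golden_digit (Suc n) u = 0"
proof (cases "golden_digit n u = 1")
  case True
  have "golden * golden_orbit (Suc n) u < 1"
  proof -
    have "golden_orbit (Suc n) u < golden - 1"
      using golden_orbit_step[of n u] True golden_orbit_range[of n u] golden_bounds by (simp add: mult_less_cancel_left2)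
    then have "golden * golden_orbit (Suc n) u < golden * (golden - 1)"
      using golden_bounds by (intro mult_strict_left_mono) auto
    then show ?thesis using golden_square by (simp add: algebra_simps)
  qed
  moreover have "0 \<le> golden * golden_orbit (Suc n) u"
    using golden_bounds golden_orbit_range[of "Suc n" u] by simp
  ultimately have "\<lfloor>golden * golden_orbit (Suc n) u\<rfloor> = 0" by linarith
  then show ?thesis by (simp add: golden_digit_def)
next
  case False
  then show ?thesis using golden_digit_binary[of n u] by auto
qed

text \<open>
  Each step expands by the factor \<open>\<tau>\<close>, while the remainders stay in \<open>[0, 1)\<close>. This is what turns
  Lebesgue measure into a measure on admissible sequences with cylinder masses at most \<open>\<tau>\<^sup>-\<^sup>k\<close>.
\<close>
lemma golden_digit_agree_imp_close:
  assumes "\<And>i. i < k \<Longrightarrow> golden_digit i u = golden_digit i v"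
  shows "\<bar>frac u - frac v\<bar> \<le> 1 / golden ^ k"
proof -
  have "golden_orbit n u - golden_orbit n v = golden ^ n * (frac u - frac v)" if "n \<le> k" for n
    using that
  proof (induction n)
    case (Suc n)
    have "golden_orbit (Suc n) u - golden_orbit (Suc n) v = golden * (golden_orbit n u - golden_orbit n v)"
      using assms[of n] Suc.prems unfolding golden_orbit_step by (simp add: algebra_simps)
    then show ?case using Suc by simp
  qed simp
  from this[of k] have "golden ^ k * \<bar>frac u - frac v\<bar> = \<bar>golden_orbit k u - golden_orbit k v\<bar>"
    using golden_bounds by (simp add: abs_mult)
  also have "\<dots> \<le> 1"
    using golden_orbit_range[of k u] golden_orbit_range[of k v] by linarith
  finally show ?thesis using golden_bounds by (simp add: field_simps)
qed

lemma golden_orbit_measurable [measurable]: "golden_orbit n \<in> borel_measurable borel"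
proof (induction n)
  case 0
  have "frac \<in> borel_measurable (borel :: real measure)" unfolding frac_def[abs_def] by measurable
  then show ?case by (simp cong: measurable_cong)
next
  case (Suc n)
  note Suc[measurable]
  have "(\<lambda>u. golden * golden_orbit n u - of_int \<lfloor>golden * golden_orbit n u\<rfloor>) \<in> borel_measurable borel"
    by measurable
  then show ?case by (simp add: frac_def[abs_def] cong: measurable_cong)
qed

lemma golden_digit_measurable [measurable]: "golden_digit n \<in> borel_measurable borel"
  unfolding golden_digit_def[abs_def] by measurable

section \<open>The law of one ratio\<close>

abbreviation unit_uniform :: "real measure" where
  "unit_uniform \<equiv> uniform_measure lborel {0..1}"

lemma prob_space_unit_uniform: "prob_space unit_uniform"
  by (rule prob_space_uniform_measure) auto

lemma emeasure_unit_uniform: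
  assumes "A \<in> sets borel"
  shows "emeasure unit_uniform A = emeasure lborel ({0..1} \<inter> A)"
  using assms by (simp add: divide_ennreal_def)

lemma nn_integral_unit_uniform:
  assumes [measurable]: "f \<in> borel_measurable borel"
  shows "(\<integral>\<^sup>+u. f u \<partial>unit_uniform) = (\<integral>\<^sup>+u. f u * indicator {0..1} u \<partial>lborel)"
  by (subst nn_integral_uniform_measure) (auto simp: divide_ennreal_def)

lemma nn_integral_unit_powr:
  fixes a :: real
  assumes "-1 < a"
  shows "(\<integral>\<^sup>+u. ennreal (u powr a) * indicator {0..1} u \<partial>lborel) = ennreal (1 / (a + 1))"
proof -
  have "((\<lambda>u. u powr a) has_integral (1 / (a + 1))) {0..1}"
    using has_integral_powr_from_0[of a 1] assms by simp
  then have "((\<lambda>u. indicator {0..1} u * u powr a) has_integral (1 / (a + 1))) UNIV"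
  proof (subst (asm) has_integral_restrict_UNIV[symmetric], elim has_integral_eq[rotated])
    fix u :: real
    show "(if u \<in> {0..1} then u powr a else 0) = indicator {0..1} u * u powr a" by simp
  qed
  then have "(\<integral>\<^sup>+u. ennreal (indicator {0..1} u * u powr a) \<partial>lborel) = ennreal (1 / (a + 1))"
    by (intro nn_integral_has_integral_lborel) auto
  moreover have "ennreal (indicator {0..1} u * u powr a) = ennreal (u powr a) * indicator {0..1} u" for u
    by (auto simp: indicator_def)
  ultimately show ?thesis by simp
qed

lemma sets_power_uniform_law [measurable_cong, simp]: "sets (power_uniform_law \<theta>) = sets borel"
  by (simp add: power_uniform_law_def)

lemma space_power_uniform_law [simp]: "space (power_uniform_law \<theta>) = UNIV"
  by (simp add: power_uniform_law_def)

lemma prob_space_power_uniform_law: "prob_space (power_uniform_law \<theta>)"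
  unfolding power_uniform_law_def
  by (intro prob_space.prob_space_distr prob_space_unit_uniform) measurable

lemma AE_unit_uniform_neq: "AE u in unit_uniform. u \<noteq> c"
proof (rule AE_uniform_measureI)
  show "AE u in lborel. u \<in> {0..1} \<longrightarrow> u \<noteq> c" 
    using AE_lborel_singleton[of c] by eventually_elim auto
qed auto

lemma AE_unit_uniform_range: "AE u in unit_uniform. 0 \<le> u \<and> u < 1"
proof -
  have "AE u in unit_uniform. u \<in> {0..1}"
    by (rule AE_uniform_measureI) auto
  then show ?thesis using AE_unit_uniform_neq[of 1] by eventually_elim auto
qed

lemma AE_power_uniform_law_pos: "AE t in power_uniform_law \<theta>. 0 < t"
proof -
  have "AE u in unit_uniform. 0 < u powr (1 / \<theta>)"
    using AE_unit_uniform_neq[of 0] AE_unit_uniform_range by eventually_elim auto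
  then show ?thesis unfolding power_uniform_law_def by (subst AE_distr_iff) auto
qed

lemma moment_power_uniform_law:
  assumes "0 < \<theta>" "-\<theta> < t"
  shows "(\<integral>\<^sup>+y. ennreal (y powr t) \<partial>power_uniform_law \<theta>) = ennreal (\<theta> / (\<theta> + t))"
proof -
  have "(\<integral>\<^sup>+y. ennreal (y powr t) \<partial>power_uniform_law \<theta>)
      = (\<integral>\<^sup>+u. ennreal ((u powr (1 / \<theta>)) powr t) \<partial>unit_uniform)"
    unfolding power_uniform_law_def by (subst nn_integral_distr) auto
  also have "\<dots> = (\<integral>\<^sup>+u. ennreal (u powr (t / \<theta>)) * indicator {0..1} u \<partial>lborel)"
    by (subst nn_integral_unit_uniform) (auto simp: powr_powr)
  also have "\<dots> = ennreal (1 / (t / \<theta> + 1))"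
    using assms by (intro nn_integral_unit_powr) (simp add: field_simps)
  also have "1 / (t / \<theta> + 1) = \<theta> / (\<theta> + t)"
    using assms by (simp add: field_simps)
  finally show ?thesis .
qed

lemma powr_difference_bound:
  fixes \<theta> \<rho> :: real
  assumes "0 < \<theta>" "0 < \<rho>" "\<rho> \<le> 1/2"
  shows "(1 + \<rho>) powr \<theta> - (1 - \<rho>) powr \<theta> \<le> 4 * \<theta> * 2 powr \<theta> * \<rho>"
proof -
  have "\<exists>z. 1 - \<rho> < z \<and> z < 1 + \<rho> \<and>
      (1 + \<rho>) powr \<theta> - (1 - \<rho>) powr \<theta> = ((1 + \<rho>) - (1 - \<rho>)) * (\<theta> * z powr (\<theta> - 1))"
  proof (rule MVT2)
    show "1 - \<rho> < 1 + \<rho>" using assms by simp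
    fix x assume "1 - \<rho> \<le> x" "x \<le> 1 + \<rho>"
    then have "0 < x" using assms by simp
    then show "((\<lambda>x. x powr \<theta>) has_real_derivative \<theta> * x powr (\<theta> - 1)) (at x)"
      by (rule has_real_derivative_powr)
  qed
  then obtain z where z: "1 - \<rho> < z" "z < 1 + \<rho>"
    and eq: "(1 + \<rho>) powr \<theta> - (1 - \<rho>) powr \<theta> = 2 * \<rho> * (\<theta> * z powr (\<theta> - 1))" by auto
  have "z powr (\<theta> - 1) = z powr \<theta> / z" using z assms by (simp add: powr_diff)
  \<comment> \<open>Splitting off \<open>1 / z\<close> treats exponents of both signs at once: \<open>1/2 \<le> z \<le> 2\<close>.\<close>
  also have "\<dots> \<le> 2 powr \<theta> / (1/2)"
    using z assms by (intro frac_le powr_mono2) auto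
  finally have "2 * \<rho> * (\<theta> * z powr (\<theta> - 1)) \<le> 2 * \<rho> * (\<theta> * (2 powr \<theta> * 2))"
    using assms by (intro mult_left_mono) auto
  then show ?thesis using eq by (simp add: algebra_simps)
qed

text \<open>
  The transversality estimate. For \<open>\<rho> \<le> 1/2\<close> the event forces \<open>\<bar>w\<bar> \<ge> 1/2\<close> and puts \<open>t\<close> between
  \<open>(1 - \<rho>) / \<bar>w\<bar>\<close> and \<open>(1 + \<rho>) / \<bar>w\<bar>\<close>. In terms of the uniform variable \<open>u = t\<^sup>\<theta>\<close> this is an interval
  of length \<open>\<bar>w\<bar>\<^sup>-\<^sup>\<theta> ((1 + \<rho>)\<^sup>\<theta> - (1 - \<rho>)\<^sup>\<theta>)\<close>, so the singularity of the density of \<open>Y\<close> at 0, present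
  for \<open>\<theta> < 1\<close>, does no harm.
\<close>
lemma power_uniform_law_affine_small_ball:
  assumes "0 < \<theta>"
  obtains C where "1 \<le> C"
    "\<And>w \<rho>. 0 < \<rho> \<Longrightarrow> emeasure (power_uniform_law \<theta>) {t. \<bar>1 + t * w\<bar> \<le> \<rho>} \<le> ennreal (C * \<rho>)"
proof -
  \<comment> \<open>The summand 2 makes the bound trivial for \<open>\<rho> > 1/2\<close>.\<close>
  define C where "C = 2 + 2 powr \<theta> * (4 * \<theta> * 2 powr \<theta>)"
  have C: "2 \<le> C" using assms by (simp add: C_def)
  have "emeasure (power_uniform_law \<theta>) {t. \<bar>1 + t * w\<bar> \<le> \<rho>} \<le> ennreal (C * \<rho>)" if "0 < \<rho>" for w \<rho>
  proof (cases "\<rho> \<le> 1/2")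
    case False
    have "emeasure (power_uniform_law \<theta>) {t. \<bar>1 + t * w\<bar> \<le> \<rho>} \<le> 1"
      by (rule prob_space.emeasure_le_1[OF prob_space_power_uniform_law])
    moreover have "2 * (1/2) \<le> C * \<rho>" using False C by (intro mult_mono) auto
    then have "1 \<le> ennreal (C * \<rho>)" using ennreal_leI[of 1 "C * \<rho>"] by simp
    ultimately show ?thesis by (rule order_trans)
  next
    case True
    let ?E = "{u. \<bar>1 + u powr (1 / \<theta>) * w\<bar> \<le> \<rho>}"
    have E: "?E \<in> sets borel" by measurable
    have "emeasure (power_uniform_law \<theta>) {t. \<bar>1 + t * w\<bar> \<le> \<rho>} = emeasure unit_uniform ?E"
      unfolding power_uniform_law_def by (subst emeasure_distr) auto
    also have "\<dots> = emeasure lborel ({0..1} \<inter> ?E)"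
      by (rule emeasure_unit_uniform[OF E])
    also have "\<dots> \<le> ennreal (C * \<rho>)"
    proof (cases "w \<le> - 1/2")
      case False
      have "{0..1} \<inter> ?E = {}"
      proof safe
        fix u :: real assume u: "u \<in> {0..1}" "\<bar>1 + u powr (1 / \<theta>) * w\<bar> \<le> \<rho>"
        have p: "0 \<le> u powr (1 / \<theta>)" "u powr (1 / \<theta>) \<le> 1"
          using u assms by (auto intro: powr_le1)
        have "- (1/2) < u powr (1 / \<theta>) * w"
        proof (cases "0 \<le> w")
          case True
          then have "0 \<le> u powr (1 / \<theta>) * w" using p by simp
          then show ?thesis by simp
        next
          case neg: False
          have "1 * w \<le> u powr (1 / \<theta>) * w" using p neg by (intro mult_right_mono_neg) auto
          then show ?thesis using False by simp
        qed
        then have False using u True by auto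
        then show "u \<in> {}" ..
      qed
      then show ?thesis by simp
    next
      case w: True
      define a where "a = ((1 - \<rho>) / - w) powr \<theta>"
      define b where "b = ((1 + \<rho>) / - w) powr \<theta>"
      have sub: "{0..1} \<inter> ?E \<subseteq> {a..b}"
      proof safe
        fix u :: real assume u: "u \<in> {0..1}" "\<bar>1 + u powr (1 / \<theta>) * w\<bar> \<le> \<rho>"
        let ?t = "u powr (1 / \<theta>)"
        have tu: "?t powr \<theta> = u" using u assms by (simp add: powr_powr)
        have "(1 - \<rho>) / - w \<le> ?t"
          using u w by (subst pos_divide_le_eq) (auto simp: abs_le_iff)
        then have "a \<le> ?t powr \<theta>" unfolding a_def using assms w True that
          by (intro powr_mono2) (auto intro!: divide_nonneg_neg)
        moreover have "?t \<le> (1 + \<rho>) / - w"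
          using u w by (subst pos_le_divide_eq) (auto simp: abs_le_iff)
        then have "?t powr \<theta> \<le> b" unfolding b_def using assms by (intro powr_mono2) auto
        ultimately show "u \<in> {a..b}" using tu by simp
      qed
      have ab: "a \<le> b" unfolding a_def b_def
      proof (rule powr_mono2)
        show "0 \<le> (1 - \<rho>) / - w" using w True by (intro divide_nonneg_pos) auto
        show "(1 - \<rho>) / - w \<le> (1 + \<rho>) / - w" using w that by (intro divide_right_mono) auto
      qed (use assms in auto)
      have "emeasure lborel ({0..1} \<inter> ?E) \<le> emeasure lborel {a..b}"
        by (rule emeasure_mono[OF sub]) simp
      also have "\<dots> = ennreal (b - a)" using ab by simp
      also have "b - a = (1 / - w) powr \<theta> * ((1 + \<rho>) powr \<theta> - (1 - \<rho>) powr \<theta>)"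
      proof -
        have "a = ((1 / - w) * (1 - \<rho>)) powr \<theta>" "b = ((1 / - w) * (1 + \<rho>)) powr \<theta>"
          by (simp_all add: a_def b_def)
        then have "a = (1 / - w) powr \<theta> * (1 - \<rho>) powr \<theta>" "b = (1 / - w) powr \<theta> * (1 + \<rho>) powr \<theta>"
          using w True that by (simp_all only: powr_mult)
        then show ?thesis by (simp only: right_diff_distrib)
      qed
      also have "\<dots> \<le> 2 powr \<theta> * (4 * \<theta> * 2 powr \<theta> * \<rho>)"
      proof (rule mult_mono)
        show "(1 / - w) powr \<theta> \<le> 2 powr \<theta>"
          using w assms by (intro powr_mono2) (auto simp: divide_simps)
        show "0 \<le> (1 + \<rho>) powr \<theta> - (1 - \<rho>) powr \<theta>"
          using assms that True by (simp add: powr_mono2)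
      qed (use powr_difference_bound[OF assms that True] in auto)
      also have "\<dots> \<le> C * \<rho>" using that unfolding C_def by (simp add: algebra_simps)
      finally show ?thesis by (simp add: ennreal_leI)
    qed
    finally show ?thesis .
  qed
  then show ?thesis using that[of C] C by auto
qed

section \<open>Almost sure growth of the partial products\<close>

abbreviation ratio_space :: "real \<Rightarrow> (nat \<Rightarrow> real) measure" where
  "ratio_space \<theta> \<equiv> Pi\<^sub>M UNIV (\<lambda>_. power_uniform_law \<theta>)"

lemma sets_ratio_space [measurable_cong]: "sets (ratio_space \<theta>) = sets (Pi\<^sub>M UNIV (\<lambda>_. borel))"
  by (intro sets_PiM_cong) simp_all

lemma space_ratio_space [simp]: "space (ratio_space \<theta>) = UNIV"
  by (simp add: space_PiM PiE_UNIV_domain)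

lemma prob_space_ratio_space: "prob_space (ratio_space \<theta>)"
  by (intro prob_space_PiM prob_space_power_uniform_law)

lemma distr_indep_eq_ratio_space:
  fixes M :: "'a measure"
  assumes "prob_space M"
    and "prob_space.indep_vars M (\<lambda>_. borel) Y UNIV"
    and "\<And>i. distr M borel (Y i) = power_uniform_law \<theta>"
  shows "distr M (Pi\<^sub>M UNIV (\<lambda>_. borel)) (\<lambda>\<omega> i. Y i \<omega>) = ratio_space \<theta>"
proof -
  interpret prob_space M by fact
  have rv: "random_variable borel (Y i)" for i
    using assms(2) by (auto simp: indep_vars_def)
  show ?thesis
    using assms(2) by (subst (asm) indep_vars_iff_distr_eq_PiM) (simp_all add: rv assms(3) restrict_def)
qed

lemma AE_ratio_space_component:
  assumes "AE t in power_uniform_law \<theta>. P t"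
  shows "AE y in ratio_space \<theta>. P (y i)"
  by (rule AE_PiM_component[where P = P]) (auto intro: assms prob_space_power_uniform_law)

lemma AE_ratios_pos: "AE y in ratio_space \<theta>. \<forall>i. 0 < y i"
  by (subst AE_all_countable) (intro allI AE_ratio_space_component AE_power_uniform_law_pos)

lemma partial_prods_pos: "(\<And>i. 0 < y i) \<Longrightarrow> 0 < partial_prods y n"
  unfolding partial_prods_def by (intro prod_pos) auto

lemma partial_prods_measurable [measurable]:
  "(\<lambda>y. partial_prods y n) \<in> borel_measurable (Pi\<^sub>M UNIV (\<lambda>_. borel))"
  unfolding partial_prods_def by measurable

lemma indep_ratios:
  "prob_space.indep_vars (ratio_space \<theta>) (\<lambda>_. power_uniform_law \<theta>) (\<lambda>i y. y i) UNIV"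
proof -
  interpret prob_space "ratio_space \<theta>" by (rule prob_space_ratio_space)
  have comp: "distr (ratio_space \<theta>) (power_uniform_law \<theta>) (\<lambda>y. y i) = power_uniform_law \<theta>" for i
    by (rule distr_PiM_component) (auto intro: prob_space_power_uniform_law)
  show ?thesis
    by (subst indep_vars_iff_distr_eq_PiM) (auto simp: comp restrict_def intro: distr_id)
qed

lemma moment_partial_prods:
  assumes "0 < \<theta>" "-\<theta> < t"
  shows "(\<integral>\<^sup>+y. ennreal (partial_prods y n powr t) \<partial>ratio_space \<theta>) = ennreal ((\<theta> / (\<theta> + t)) ^ Suc n)"
proof -
  interpret prob_space "ratio_space \<theta>" by (rule prob_space_ratio_space)
  have comp: "distr (ratio_space \<theta>) (power_uniform_law \<theta>) (\<lambda>y. y i) = power_uniform_law \<theta>" for i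
    by (rule distr_PiM_component) (auto intro: prob_space_power_uniform_law)
  have single: "(\<integral>\<^sup>+y. ennreal (y i powr t) \<partial>ratio_space \<theta>) = ennreal (\<theta> / (\<theta> + t))" for i
  proof -
    have "(\<integral>\<^sup>+x. ennreal (x powr t) \<partial>power_uniform_law \<theta>)
        = (\<integral>\<^sup>+x. ennreal (x powr t) \<partial>distr (ratio_space \<theta>) (power_uniform_law \<theta>) (\<lambda>y. y i))"
      by (simp only: comp)
    also have "\<dots> = (\<integral>\<^sup>+y. ennreal (y i powr t) \<partial>ratio_space \<theta>)"
      by (rule nn_integral_distr) measurable
    finally show ?thesis using moment_power_uniform_law[OF assms] by simp
  qed
  have "(\<integral>\<^sup>+y. ennreal (partial_prods y n powr t) \<partial>ratio_space \<theta>)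
      = (\<integral>\<^sup>+y. (\<Prod>i\<le>n. ennreal (y i powr t)) \<partial>ratio_space \<theta>)"
  proof (rule nn_integral_cong_AE)
    show "AE y in ratio_space \<theta>. ennreal (partial_prods y n powr t) = (\<Prod>i\<le>n. ennreal (y i powr t))"
      using AE_ratios_pos
    proof eventually_elim
      case (elim y)
      have "partial_prods y n powr t = (\<Prod>i\<le>n. y i powr t)"
        unfolding partial_prods_def by (rule prod_powr_distrib)
      then show ?case by (simp add: prod_ennreal)
    qed
  qed
  also have "\<dots> = (\<Prod>i\<le>n. \<integral>\<^sup>+y. ennreal (y i powr t) \<partial>ratio_space \<theta>)"
  proof (rule indep_vars_nn_integral)
    have "indep_vars (\<lambda>_. borel) (\<lambda>i y. (\<lambda>x. ennreal (x powr t)) (y i)) UNIV"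
      by (rule indep_vars_compose2[OF indep_ratios]) measurable
    then show "indep_vars (\<lambda>_. borel) (\<lambda>i y. ennreal (y i powr t)) {..n}"
      by (rule indep_vars_subset) auto
  qed auto
  also have "\<dots> = ennreal ((\<theta> / (\<theta> + t)) ^ Suc n)"
    using assms by (simp add: single ennreal_power[symmetric] ennreal_mult' del: power_Suc)
  finally show ?thesis .
qed

text \<open>
  The expectation of \<open>\<Sum> q\<^sup>n X\<^sub>n\<^sup>t\<close> is a convergent geometric series, so almost surely the sum is
  finite and its terms are bounded. With \<open>t\<close> near 0 of either sign this replaces the law of large
  numbers.
\<close>
lemma AE_partial_prods_moment_bound:
  assumes "0 < \<theta>" "-\<theta> < t" "0 \<le> q" "q * (\<theta> / (\<theta> + t)) < 1"
  shows "AE y in ratio_space \<theta>. \<exists>C. \<forall>n. q ^ n * partial_prods y n powr t \<le> C"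
proof -
  define a where "a = \<theta> / (\<theta> + t)"
  have a: "0 < a" "q * a < 1" using assms by (auto simp: a_def)
  let ?f = "\<lambda>y. \<Sum>n. ennreal (q ^ n * partial_prods y n powr t)"
  have "(\<integral>\<^sup>+y. ?f y \<partial>ratio_space \<theta>)
      = (\<Sum>n. \<integral>\<^sup>+y. ennreal (q ^ n * partial_prods y n powr t) \<partial>ratio_space \<theta>)"
    by (rule nn_integral_suminf) measurable
  also have "\<dots> = (\<Sum>n. ennreal (a * (q * a) ^ n))"
  proof (rule suminf_cong)
    fix n
    have "(\<integral>\<^sup>+y. ennreal (q ^ n * partial_prods y n powr t) \<partial>ratio_space \<theta>)
        = ennreal (q ^ n) * (\<integral>\<^sup>+y. ennreal (partial_prods y n powr t) \<partial>ratio_space \<theta>)"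
      using assms(3) by (subst nn_integral_cmult[symmetric]) (auto simp: ennreal_mult')
    also have "\<dots> = ennreal (q ^ n * a ^ Suc n)"
      using moment_partial_prods[OF assms(1,2)] assms(3) a by (simp add: a_def ennreal_mult' del: power_Suc)
    finally show "(\<integral>\<^sup>+y. ennreal (q ^ n * partial_prods y n powr t) \<partial>ratio_space \<theta>) = ennreal (a * (q * a) ^ n)"
      by (simp add: power_mult_distrib algebra_simps)
  qed
  also have "\<dots> \<noteq> \<infinity>"
  proof -
    have "summable (\<lambda>n. a * (q * a) ^ n)"
      using a assms(3) by (intro summable_mult summable_geometric) simp
    then show ?thesis using a assms(3) by (subst suminf_ennreal2) auto
  qed
  finally have "AE y in ratio_space \<theta>. ?f y \<noteq> \<infinity>"
    by (intro nn_integral_PInf_AE) measurable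
  then show ?thesis
  proof eventually_elim
    case (elim y)
    then obtain C where C: "?f y = ennreal C" "0 \<le> C" by (cases "?f y") (auto simp: top_unique)
    have "ennreal (q ^ n * partial_prods y n powr t) \<le> ?f y" for n
      using sum_le_suminf[of "\<lambda>n. ennreal (q ^ n * partial_prods y n powr t)" "{n}"] by simp
    then have "q ^ n * partial_prods y n powr t \<le> C" for n
      using C by (metis ennreal_le_iff)
    then show ?case by blast
  qed
qed

text \<open>
  With \<open>q = \<delta>\<^sup>-\<^sup>t\<close> the moment condition reads \<open>ln (1 + t / \<theta>) + t ln \<delta> > 0\<close>. The left side vanishes at
  \<open>t = 0\<close> with derivative \<open>1 / \<theta> + ln \<delta> > 0\<close>, so small positive \<open>t\<close> work.
\<close>
lemma AE_partial_prods_upper: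
  assumes "0 < \<theta>" "exp (- 1 / \<theta>) < \<delta>"
  shows "AE y in ratio_space \<theta>. \<exists>C. \<forall>n. partial_prods y n \<le> C * \<delta> ^ n"
proof -
  have \<delta>: "0 < \<delta>" "-1 / \<theta> < ln \<delta>"
    using assms(2) by (metis exp_gt_zero order.strict_trans)
       (metis assms(2) exp_gt_zero exp_less_cancel_iff exp_ln order.strict_trans)
  let ?g = "\<lambda>t. ln (1 + t / \<theta>) + t * ln \<delta>"
  have "(?g has_real_derivative 1 / \<theta> + ln \<delta>) (at 0)"
    using assms(1) by (auto intro!: derivative_eq_intros)
  from DERIV_pos_inc_right[OF this] obtain d where d: "0 < d" "\<And>h. 0 < h \<Longrightarrow> h < d \<Longrightarrow> 0 < ?g h"
    using \<delta> by auto
  define t where "t = d / 2"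
  have t: "0 < t" "0 < ?g t" using d(1) d(2)[of t] by (auto simp: t_def)
  have "\<delta> powr (- t) * (\<theta> / (\<theta> + t)) = exp (- ?g t)"
  proof -
    have "\<theta> / (\<theta> + t) = 1 / (1 + t / \<theta>)" using assms(1) t by (simp add: field_simps)
    also have "\<dots> = exp (- ln (1 + t / \<theta>))"
      using assms(1) t by (simp add: exp_minus field_simps add_pos_pos)
    finally have "\<theta> / (\<theta> + t) = exp (- ln (1 + t / \<theta>))" .
    moreover have "\<delta> powr (- t) = exp (- (t * ln \<delta>))" using \<delta> by (simp add: powr_def)
    ultimately show ?thesis by (simp add: exp_add[symmetric])
  qed
  also have "\<dots> < 1" using t by simp
  finally have "AE y in ratio_space \<theta>. \<exists>C. \<forall>n. (\<delta> powr (- t)) ^ n * partial_prods y n powr t \<le> C"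
    using assms t by (intro AE_partial_prods_moment_bound) auto
  then show ?thesis using AE_ratios_pos
  proof eventually_elim
    case (elim y)
    then obtain C where C: "\<And>n. (\<delta> powr (- t)) ^ n * partial_prods y n powr t \<le> C" by auto
    have pos: "0 < partial_prods y n" for n using elim by (intro partial_prods_pos) auto
    have "0 \<le> C" using C[of 0] by (simp add: order_trans[OF powr_ge_zero])
    have "partial_prods y n \<le> C powr (1 / t) * \<delta> ^ n" for n
    proof -
      have "(\<delta> powr (- t)) ^ n * partial_prods y n powr t = (partial_prods y n / \<delta> ^ n) powr t"
        using \<delta> pos[of n] by (simp add: powr_divide powr_minus powr_realpow[symmetric] powr_powr field_simps)
      then have "((partial_prods y n / \<delta> ^ n) powr t) powr (1 / t) \<le> C powr (1 / t)"
        using C[of n] t by (intro powr_mono2) auto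
      moreover have "0 < partial_prods y n / \<delta> ^ n" using \<delta> pos[of n] by simp
      ultimately have "partial_prods y n / \<delta> ^ n \<le> C powr (1 / t)"
        using t by (simp only: powr_powr) (simp del: abs_divide)
      then show ?thesis using \<delta> by (simp add: field_simps)
    qed
    then show ?case by blast
  qed
qed

text \<open>
  The same function with \<open>\<eta>\<close> in place of \<open>\<delta>\<close> has a negative derivative at 0, so small negative
  exponents work.
\<close>
lemma AE_partial_prods_lower:
  assumes "0 < \<theta>" "0 < \<eta>" "\<eta> < exp (- 1 / \<theta>)"
  shows "AE y in ratio_space \<theta>. \<exists>C. \<forall>n. \<eta> ^ n \<le> C * partial_prods y n"
proof -
  have \<eta>: "ln \<eta> < -1 / \<theta>"
    using assms(2,3) by (metis exp_less_cancel_iff exp_ln)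
  let ?g = "\<lambda>t. ln (1 + t / \<theta>) + t * ln \<eta>"
  have "(?g has_real_derivative 1 / \<theta> + ln \<eta>) (at 0)"
    using assms(1) by (auto intro!: derivative_eq_intros)
  from DERIV_neg_dec_left[OF this] obtain d where d: "0 < d" "\<And>h. 0 < h \<Longrightarrow> h < d \<Longrightarrow> 0 < ?g (- h)"
    using \<eta> by auto
  \<comment> \<open>The moment of order \<open>- t\<close> exists only for \<open>t < \<theta>\<close>.\<close>
  define t where "t = min (d / 2) (\<theta> / 2)"
  have t: "0 < t" "t < \<theta>" "0 < ?g (- t)" using d(1) d(2)[of t] assms(1) by (auto simp: t_def)
  have "\<eta> powr t * (\<theta> / (\<theta> + - t)) = exp (- ?g (- t))"
  proof -
    have "\<theta> / (\<theta> + - t) = 1 / (1 + - t / \<theta>)" using assms(1) t by (simp add: field_simps)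
    also have "\<dots> = exp (- ln (1 + - t / \<theta>))"
      using assms(1) t by (simp add: exp_minus field_simps)
    finally have "\<theta> / (\<theta> + - t) = exp (- ln (1 + - t / \<theta>))" .
    moreover have "\<eta> powr t = exp (- (- t * ln \<eta>))" using assms by (simp add: powr_def)
    ultimately show ?thesis by (simp add: exp_add[symmetric])
  qed
  also have "\<dots> < 1" using t by simp
  finally have "AE y in ratio_space \<theta>. \<exists>C. \<forall>n. (\<eta> powr t) ^ n * partial_prods y n powr (- t) \<le> C"
    using assms t by (intro AE_partial_prods_moment_bound) auto
  then show ?thesis using AE_ratios_pos
  proof eventually_elim
    case (elim y)
    then obtain C where C: "\<And>n. (\<eta> powr t) ^ n * partial_prods y n powr (- t) \<le> C" by auto
    have pos: "0 < partial_prods y n" for n using elim by (intro partial_prods_pos) auto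
    have "\<eta> ^ n \<le> C powr (1 / t) * partial_prods y n" for n
    proof -
      have "(\<eta> powr t) ^ n * partial_prods y n powr (- t) = (\<eta> ^ n / partial_prods y n) powr t"
        using assms pos[of n] by (simp add: powr_divide powr_minus powr_realpow[symmetric] powr_powr field_simps)
      then have "((\<eta> ^ n / partial_prods y n) powr t) powr (1 / t) \<le> C powr (1 / t)"
        using C[of n] t by (intro powr_mono2) auto
      moreover have "0 < \<eta> ^ n / partial_prods y n" using assms pos[of n] by simp
      ultimately have "\<eta> ^ n / partial_prods y n \<le> C powr (1 / t)"
        using t by (simp only: powr_powr) (simp del: abs_divide)
      then show ?thesis using pos[of n] by (simp add: field_simps)
    qed
    then show ?case by blast
  qed
qed

section \<open>A small ball estimate for digit series\<close>

text \<open>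
  For \<open>u\<close> uniform on \<open>[0, 1]\<close> this is the random point of the set of restricted sums whose law is
  used as a Frostman measure.
\<close>
definition golden_projection :: "(nat \<Rightarrow> real) \<Rightarrow> real \<Rightarrow> real" where
  "golden_projection y u = (\<Sum>i. golden_digit i u * partial_prods y i)"

lemma partial_prods_compose_measurable [measurable (raw)]:
  assumes [measurable]: "f \<in> M \<rightarrow>\<^sub>M Pi\<^sub>M UNIV (\<lambda>_. borel)"
  shows "(\<lambda>x. partial_prods (f x) n) \<in> borel_measurable M"
  using measurable_compose[OF assms partial_prods_measurable] by simp

lemma golden_projection_measurable [measurable (raw)]:
  assumes [measurable]: "f \<in> M \<rightarrow>\<^sub>M Pi\<^sub>M UNIV (\<lambda>_. borel)" "g \<in> borel_measurable M"
  shows "(\<lambda>x. golden_projection (f x) (g x)) \<in> borel_measurable M"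
  unfolding golden_projection_def by measurable

text \<open>
  One constant controls both growth bounds, so that countably many of these sets cover almost all
  ratio sequences. For \<open>\<delta> < 1\<close> all digit series over a member converge absolutely.
\<close>
definition regular_ratios :: "real \<Rightarrow> real \<Rightarrow> real \<Rightarrow> (nat \<Rightarrow> real) set" where
  "regular_ratios \<delta> \<eta> C =
     {y. (\<forall>i. 0 < y i) \<and> (\<forall>n. partial_prods y n \<le> C * \<delta> ^ n) \<and> (\<forall>n. \<eta> ^ n \<le> C * partial_prods y n)}"

lemma regular_ratios_sets [measurable]: "regular_ratios \<delta> \<eta> C \<in> sets (Pi\<^sub>M UNIV (\<lambda>_. borel))"
proof -
  have "Measurable.pred (Pi\<^sub>M UNIV (\<lambda>_. borel))
     (\<lambda>y. (\<forall>i. 0 < y i) \<and> (\<forall>n. partial_prods y n \<le> C * \<delta> ^ n) \<and> (\<forall>n. \<eta> ^ n \<le> C * partial_prods y n))"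
    by measurable
  then show ?thesis unfolding regular_ratios_def pred_def by (simp add: space_PiM PiE_UNIV_domain)
qed

lemma AE_regular_ratios:
  assumes "0 < \<theta>" "exp (- 1 / \<theta>) < \<delta>" "0 < \<eta>" "\<eta> < exp (- 1 / \<theta>)"
  shows "AE y in ratio_space \<theta>. \<exists>N. y \<in> regular_ratios \<delta> \<eta> (real (Suc N))"
  using AE_partial_prods_upper[OF assms(1,2)] AE_partial_prods_lower[OF assms(1,3,4)] AE_ratios_pos
proof eventually_elim
  case (elim y)
  then obtain C D where C: "\<And>n. partial_prods y n \<le> C * \<delta> ^ n"
    and D: "\<And>n. \<eta> ^ n \<le> D * partial_prods y n" by auto
  have \<delta>: "0 < \<delta>" using assms(2) by (metis exp_gt_zero order.strict_trans)
  have pos: "0 < partial_prods y n" for n using elim by (intro partial_prods_pos) auto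
  obtain N where N: "max C D \<le> real N" using real_arch_simple by blast
  have "partial_prods y n \<le> real (Suc N) * \<delta> ^ n" for n
    using C[of n] N \<delta> by (elim order_trans) (intro mult_right_mono, auto)
  moreover have "\<eta> ^ n \<le> real (Suc N) * partial_prods y n" for n
    using D[of n] N pos[of n] by (elim order_trans) (intro mult_right_mono, auto)
  ultimately show ?case using elim unfolding regular_ratios_def by blast
qed

lemma summable_digit_series:
  assumes "y \<in> regular_ratios \<delta> \<eta> C" "0 < \<delta>" "\<delta> < 1" "\<And>i. \<bar>c i\<bar> \<le> 1"
  shows "summable (\<lambda>i. c i * partial_prods y i)"
proof (rule summable_comparison_test')
  show "summable (\<lambda>n. C * \<delta> ^ n)"
    using assms(2,3) by (intro summable_mult summable_geometric) simp
  fix n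
  have pos: "0 < partial_prods y n"
    using assms(1) by (intro partial_prods_pos) (auto simp: regular_ratios_def)
  have "\<bar>c n\<bar> * partial_prods y n \<le> 1 * partial_prods y n"
    using assms(4) pos by (intro mult_right_mono) auto
  also have "\<dots> \<le> C * \<delta> ^ n" using assms(1) by (simp add: regular_ratios_def)
  finally show "norm (c n * partial_prods y n) \<le> C * \<delta> ^ n"
    using pos by (simp add: abs_mult)
qed

lemma partial_prods_split:
  "partial_prods y (Suc k + i) = partial_prods y k * y (Suc k) * (\<Prod>j\<in>{Suc (Suc k)..Suc k + i}. y j)"
proof (induction i)
  case 0
  then show ?case by (simp add: partial_prods_def)
next
  case (Suc i)
  have "partial_prods y (Suc k + Suc i) = partial_prods y (Suc k + i) * y (Suc (Suc k + i))"
    by (simp add: partial_prods_def)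
  also have "\<dots> = partial_prods y k * y (Suc k) * ((\<Prod>j\<in>{Suc (Suc k)..Suc k + i}. y j) * y (Suc (Suc k + i)))"
    using Suc by simp
  also have "(\<Prod>j\<in>{Suc (Suc k)..Suc k + i}. y j) * y (Suc (Suc k + i)) = (\<Prod>j\<in>{Suc (Suc k)..Suc k + Suc i}. y j)"
    by (simp add: prod.nat_ivl_Suc')
  finally show ?case .
qed

text \<open>
  Conditioning on all ratios except the \<open>m\<close>-th: by Fubini it is enough to bound each section, where
  \<open>W\<close> is a constant.
\<close>
lemma emeasure_affine_in_one_ratio:
  assumes ball: "\<And>w. emeasure (power_uniform_law \<theta>) {t. \<bar>1 + t * w\<bar> \<le> \<rho>} \<le> c"
    and W [measurable]: "W \<in> borel_measurable (Pi\<^sub>M UNIV (\<lambda>_. borel))"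
    and indep: "\<And>y t. W (y(m := t)) = W y"
  shows "emeasure (ratio_space \<theta>) {y. \<bar>1 + y m * W y\<bar> \<le> \<rho>} \<le> c"
proof -
  let ?L = "power_uniform_law \<theta>" and ?R = "Pi\<^sub>M (- {m}) (\<lambda>_. power_uniform_law \<theta>)"
  let ?E = "{y. \<bar>1 + y m * W y\<bar> \<le> \<rho>}"
  interpret L: prob_space ?L by (rule prob_space_power_uniform_law)
  interpret R: prob_space ?R by (intro prob_space_PiM prob_space_power_uniform_law)
  interpret LR: pair_sigma_finite ?L ?R ..
  have ins: "insert m (- {m}) = UNIV" by auto
  have "distr (?L \<Otimes>\<^sub>M ?R) (Pi\<^sub>M (insert m (- {m})) (\<lambda>_. ?L)) (\<lambda>(x, X). X(m := x))
      = Pi\<^sub>M (insert m (- {m})) (\<lambda>_. ?L)"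
    by (rule distr_pair_PiM_eq_PiM) (auto intro: prob_space_power_uniform_law)
  then have dist: "distr (?L \<Otimes>\<^sub>M ?R) (ratio_space \<theta>) (\<lambda>(x, X). X(m := x)) = ratio_space \<theta>"
    by (simp only: ins)
  have upd: "(\<lambda>(x, X). X(m := x)) \<in> (?L \<Otimes>\<^sub>M ?R) \<rightarrow>\<^sub>M ratio_space \<theta>"
    using measurable_add_dim[of m "- {m}" "\<lambda>_. ?L"] 
    by (subst (asm) ins) (simp add: measurable_pair_swap_iff[of _ ?L] case_prod_beta')
  have "Measurable.pred (ratio_space \<theta>) (\<lambda>y. \<bar>1 + y m * W y\<bar> \<le> \<rho>)" by measurable
  then have E: "?E \<in> sets (ratio_space \<theta>)" by (simp add: pred_def)
  have "emeasure (ratio_space \<theta>) ?E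
      = emeasure (?L \<Otimes>\<^sub>M ?R) ((\<lambda>(x, X). X(m := x)) -` ?E \<inter> space (?L \<Otimes>\<^sub>M ?R))"
    by (subst dist[symmetric]) (rule emeasure_distr[OF upd E])
  also have "\<dots> = (\<integral>\<^sup>+X. emeasure ?L ((\<lambda>x. (x, X)) -` ((\<lambda>(x, X). X(m := x)) -` ?E \<inter> space (?L \<Otimes>\<^sub>M ?R))) \<partial>?R)"
    by (rule LR.emeasure_pair_measure_alt2) (rule measurable_sets[OF upd E])
  also have "\<dots> \<le> (\<integral>\<^sup>+X. c \<partial>?R)"
  proof (rule nn_integral_mono)
    fix X
    have "emeasure ?L ((\<lambda>x. (x, X)) -` ((\<lambda>(x, X). X(m := x)) -` ?E \<inter> space (?L \<Otimes>\<^sub>M ?R)))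
        \<le> emeasure ?L {t. \<bar>1 + t * W X\<bar> \<le> \<rho>}"
    proof (rule emeasure_mono)
      show "(\<lambda>x. (x, X)) -` ((\<lambda>(x, X). X(m := x)) -` ?E \<inter> space (?L \<Otimes>\<^sub>M ?R)) \<subseteq> {t. \<bar>1 + t * W X\<bar> \<le> \<rho>}"
        by (auto simp: indep)
      show "{t. \<bar>1 + t * W X\<bar> \<le> \<rho>} \<in> sets ?L" by simp
    qed
    also have "\<dots> \<le> c" by (rule ball)
    finally show "emeasure ?L ((\<lambda>x. (x, X)) -` ((\<lambda>(x, X). X(m := x)) -` ?E \<inter> space (?L \<Otimes>\<^sub>M ?R))) \<le> c" .
  qed
  also have "\<dots> = c" by (simp add: R.emeasure_space_1)
  finally show ?thesis .
qed

text \<open>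
  From index \<open>k\<close> on, \<open>X\<^sub>k\<close> factors out of the series and leaves \<open>\<plusminus> (1 + y\<^sub>k\<^sub>+\<^sub>1 W)\<close> with \<open>W\<close> free of
  \<open>y\<^sub>k\<^sub>+\<^sub>1\<close>. On regular ratios \<open>X\<^sub>k\<close> is at least \<open>\<eta>\<^sup>k / C\<close>; bounding it pathwise in this way loses only
  the typical rate, whereas the moment of \<open>1 / X\<^sub>k\<close> would lose more.
\<close>
lemma small_ball_digit_series:
  fixes c :: "nat \<Rightarrow> real"
  assumes ball: "\<And>w \<rho>. 0 < \<rho> \<Longrightarrow> emeasure (power_uniform_law \<theta>) {t. \<bar>1 + t * w\<bar> \<le> \<rho>} \<le> ennreal (B * \<rho>)"
    and \<delta>: "0 < \<delta>" "\<delta> < 1" and "0 < \<eta>" "0 < C" "0 < r"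
    and c: "\<And>i. \<bar>c i\<bar> \<le> 1" "\<And>i. i < k \<Longrightarrow> c i = 0" "\<bar>c k\<bar> = 1"
  shows "emeasure (ratio_space \<theta>) {y \<in> regular_ratios \<delta> \<eta> C. \<bar>\<Sum>i. c i * partial_prods y i\<bar> \<le> r}
      \<le> ennreal (B * (r * C / \<eta> ^ k))"
proof -
  define W where "W y = (\<Sum>i. c k * c (Suc k + i) * (\<Prod>j\<in>{Suc (Suc k)..Suc k + i}. y j))" for y :: "nat \<Rightarrow> real"
  have W: "W \<in> borel_measurable (Pi\<^sub>M UNIV (\<lambda>_. borel))"
    unfolding W_def[abs_def] by measurable
  have indep: "W (y(Suc k := t)) = W y" for y t
    unfolding W_def by (intro arg_cong[where f = suminf] ext arg_cong2[where f = "(*)"] prod.cong) auto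
  define \<rho> where "\<rho> = r * C / \<eta> ^ k"
  have \<rho>: "0 < \<rho>" using assms by (simp add: \<rho>_def)
  have sub: "{y \<in> regular_ratios \<delta> \<eta> C. \<bar>\<Sum>i. c i * partial_prods y i\<bar> \<le> r} \<subseteq> {y. \<bar>1 + y (Suc k) * W y\<bar> \<le> \<rho>}"
  proof safe
    fix y assume y: "y \<in> regular_ratios \<delta> \<eta> C" and le: "\<bar>\<Sum>i. c i * partial_prods y i\<bar> \<le> r"
    have ypos: "0 < y i" for i using y by (simp add: regular_ratios_def)
    have pos: "0 < partial_prods y n" for n by (rule partial_prods_pos) (rule ypos)
    let ?f = "\<lambda>i. c i * partial_prods y i"
    have sm: "summable ?f" by (rule summable_digit_series[OF y \<delta> c(1)])
    have ck: "c k * c k = 1" using c(3) by (metis abs_mult_self_eq mult_1)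
    have term_eq: "?f (Suc k + i)
        = (c k * partial_prods y k * y (Suc k)) * (c k * c (Suc k + i) * (\<Prod>j\<in>{Suc (Suc k)..Suc k + i}. y j))" for i
    proof -
      let ?p = "\<Prod>j\<in>{Suc (Suc k)..Suc k + i}. y j"
      have "(c k * partial_prods y k * y (Suc k)) * (c k * c (Suc k + i) * ?p)
          = (c k * c k) * (c (Suc k + i) * (partial_prods y k * y (Suc k) * ?p))"
        by (simp only: mult_ac)
      then show ?thesis unfolding partial_prods_split by (simp only: ck mult_1)
    qed
    have nz: "c k * partial_prods y k * y (Suc k) \<noteq> 0" using ck pos[of k] ypos[of "Suc k"] by auto
    have sm': "summable (\<lambda>i. ?f (Suc k + i))"
      using summable_ignore_initial_segment[OF sm, of "Suc k"] by (simp only: add.commute)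
    have "(\<Sum>i. ?f (Suc k + i)) = (c k * partial_prods y k * y (Suc k)) * W y"
      unfolding W_def using sm' nz unfolding term_eq by (intro suminf_mult) (simp add: summable_cmult_iff)
    moreover have "(\<Sum>i. ?f i) = (\<Sum>i. ?f (i + Suc k)) + (\<Sum>i<Suc k. ?f i)"
      by (rule suminf_split_initial_segment[OF sm])
    moreover have "(\<Sum>i<Suc k. ?f i) = c k * partial_prods y k" using c(2) by simp
    ultimately have "(\<Sum>i. ?f i) = (c k * partial_prods y k) * (1 + y (Suc k) * W y)"
      by (simp add: algebra_simps)
    then have "partial_prods y k * \<bar>1 + y (Suc k) * W y\<bar> \<le> r"
      using le c(3) pos[of k] by (simp add: abs_mult)
    moreover have "\<eta> ^ k / C \<le> partial_prods y k"
      using y assms(5) by (simp add: regular_ratios_def field_simps)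
    then have "\<eta> ^ k / C * \<bar>1 + y (Suc k) * W y\<bar> \<le> partial_prods y k * \<bar>1 + y (Suc k) * W y\<bar>"
      by (intro mult_right_mono) auto
    ultimately have "\<eta> ^ k / C * \<bar>1 + y (Suc k) * W y\<bar> \<le> r" by linarith
    then show "\<bar>1 + y (Suc k) * W y\<bar> \<le> \<rho>"
      using assms(4,5) unfolding \<rho>_def by (simp add: field_simps)
  qed
  have "Measurable.pred (ratio_space \<theta>) (\<lambda>y. \<bar>1 + y (Suc k) * W y\<bar> \<le> \<rho>)" using W by measurable
  then have "emeasure (ratio_space \<theta>) {y \<in> regular_ratios \<delta> \<eta> C. \<bar>\<Sum>i. c i * partial_prods y i\<bar> \<le> r}
      \<le> emeasure (ratio_space \<theta>) {y. \<bar>1 + y (Suc k) * W y\<bar> \<le> \<rho>}"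
    by (intro emeasure_mono[OF sub]) (simp add: pred_def)
  also have "\<dots> \<le> ennreal (B * \<rho>)"
    by (rule emeasure_affine_in_one_ratio[OF ball[OF \<rho>] W indep])
  finally show ?thesis by (simp add: \<rho>_def)
qed

section \<open>The expected correlation\<close>

text \<open>
  The mass that the square of the law of \<open>golden_projection y\<close> gives to the pairs at distance at
  most \<open>r\<close>. Working with it instead of an energy integral avoids singular kernels on the diagonal and
  serves positive measure and dimension alike.
\<close>
definition correlation :: "(nat \<Rightarrow> real) \<Rightarrow> real \<Rightarrow> ennreal" where
  "correlation y r = emeasure (unit_uniform \<Otimes>\<^sub>M unit_uniform)
     {p. \<bar>golden_projection y (fst p) - golden_projection y (snd p)\<bar> \<le> r}"

lemma golden_projection_measurable_unit [measurable]: "golden_projection y \<in> borel_measurable borel"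
  unfolding golden_projection_def[abs_def] by measurable

lemma golden_projection_difference:
  assumes "y \<in> regular_ratios \<delta> \<eta> C" "0 < \<delta>" "\<delta> < 1"
  shows "golden_projection y u - golden_projection y v
       = (\<Sum>i. (golden_digit i u - golden_digit i v) * partial_prods y i)"
proof -
  have "\<bar>golden_digit i u\<bar> \<le> 1" for i u using golden_digit_binary[of i u] by auto
  then have "summable (\<lambda>i. golden_digit i u * partial_prods y i)" for u
    by (intro summable_digit_series[OF assms])
  then show ?thesis
    unfolding golden_projection_def by (simp add: suminf_diff left_diff_distrib)
qed

text \<open>
  The first index \<open>k\<close> where the digits differ satisfies \<open>\<bar>u - v\<bar> \<le> \<tau>\<^sup>-\<^sup>k\<close>, so the loss \<open>\<eta>\<^sup>-\<^sup>s\<^sup>k\<close> can be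
  expressed by \<open>\<bar>u - v\<bar>\<close> alone. The exponent \<open>s\<close> comes from interpolating the linear bound with the
  trivial bound 1.
\<close>
lemma small_ball_two_points:
  assumes ball: "\<And>w \<rho>. 0 < \<rho> \<Longrightarrow> emeasure (power_uniform_law \<theta>) {t. \<bar>1 + t * w\<bar> \<le> \<rho>} \<le> ennreal (B * \<rho>)"
    and "1 \<le> B" and \<delta>: "0 < \<delta>" "\<delta> < 1" and "0 < \<eta>" "0 < C" "0 < r"
    and s: "0 < s" "s \<le> 1" and \<beta>: "0 \<le> \<beta>" "\<eta> powr (- s) \<le> golden powr \<beta>"
    and uv: "0 \<le> u" "u < 1" "0 \<le> v" "v < 1" "u \<noteq> v"
  shows "emeasure (ratio_space \<theta>)
      {y \<in> regular_ratios \<delta> \<eta> C. \<bar>golden_projection y u - golden_projection y v\<bar> \<le> r}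
      \<le> ennreal (B * C powr s * r powr s * \<bar>u - v\<bar> powr (- \<beta>))"
proof -
  let ?A = "{y \<in> regular_ratios \<delta> \<eta> C. \<bar>golden_projection y u - golden_projection y v\<bar> \<le> r}"
  define c where "c i = golden_digit i u - golden_digit i v" for i
  have frac: "frac u = u" "frac v = v" using uv by (simp_all add: frac_eq)
  have "\<exists>i. c i \<noteq> 0"
  proof (rule ccontr)
    assume "\<nexists>i. c i \<noteq> 0"
    then have le: "\<bar>u - v\<bar> \<le> 1 / golden ^ k" for k
      using golden_digit_agree_imp_close[of k u v] by (simp add: c_def frac)
    have "(\<lambda>k. (1 / golden) ^ k) \<longlonglongrightarrow> 0"
      using golden_bounds by (intro LIMSEQ_realpow_zero) auto
    then have "\<bar>u - v\<bar> \<le> 0"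
      by (rule tendsto_lowerbound) (use le in \<open>auto simp: power_one_over\<close>)
    then show False using uv by simp
  qed
  define k where "k = (LEAST i. c i \<noteq> 0)"
  have ck: "c k \<noteq> 0" unfolding k_def using \<open>\<exists>i. c i \<noteq> 0\<close> by (rule LeastI_ex)
  have c0: "c i = 0" if "i < k" for i using not_less_Least[of i "\<lambda>i. c i \<noteq> 0"] that by (auto simp: k_def)
  have c1: "\<bar>c i\<bar> \<le> 1" "c i \<noteq> 0 \<Longrightarrow> \<bar>c i\<bar> = 1" for i
    using golden_digit_binary[of i u] golden_digit_binary[of i v] by (auto simp: c_def)
  define \<rho> where "\<rho> = r * C / \<eta> ^ k"
  have \<rho>: "0 < \<rho>" using assms by (simp add: \<rho>_def)
  have "?A = {y \<in> regular_ratios \<delta> \<eta> C. \<bar>\<Sum>i. c i * partial_prods y i\<bar> \<le> r}"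
    by (auto simp: golden_projection_difference[OF _ \<delta>] c_def)
  then have 1: "emeasure (ratio_space \<theta>) ?A \<le> ennreal (B * \<rho>)"
    unfolding \<rho>_def
    using small_ball_digit_series[where c = c and k = k and \<theta> = \<theta> and B = B and \<delta> = \<delta> and \<eta> = \<eta> and C = C and r = r]
      ball \<delta> assms(5-7) c1(1) c0 c1(2)[OF ck] by simp
  have 2: "emeasure (ratio_space \<theta>) ?A \<le> 1"
    by (rule prob_space.emeasure_le_1[OF prob_space_ratio_space])
  have "emeasure (ratio_space \<theta>) ?A \<le> ennreal (B * \<rho> powr s)"
  proof (cases "\<rho> \<le> 1")
    case True
    have "\<rho> powr 1 \<le> \<rho> powr s" using True \<rho> s by (intro powr_mono') auto
    then have "B * \<rho> \<le> B * \<rho> powr s" using assms(2) \<rho> by simp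
    then show ?thesis by (rule order_trans[OF 1 ennreal_leI])
  next
    case False
    then have "1 \<le> \<rho> powr s" using s by (intro ge_one_powr_ge_zero) auto
    then have "1 * 1 \<le> B * \<rho> powr s" using assms(2) by (intro mult_mono) auto
    then have "1 \<le> ennreal (B * \<rho> powr s)" using ennreal_leI[of 1] by simp
    then show ?thesis by (rule order_trans[OF 2])
  qed
  also have "B * \<rho> powr s \<le> B * C powr s * r powr s * \<bar>u - v\<bar> powr (- \<beta>)"
  proof -
    have "\<rho> powr s = C powr s * r powr s * (\<eta> powr (- s)) ^ k"
      using assms by (simp add: \<rho>_def powr_mult powr_divide powr_minus powr_realpow[symmetric] powr_powr field_simps)
    also have "(\<eta> powr (- s)) ^ k \<le> (golden powr \<beta>) ^ k"
      using \<beta> by (intro power_mono) auto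
    also have "(golden powr \<beta>) ^ k = (1 / golden ^ k) powr (- \<beta>)"
      using golden_bounds
      by (simp add: powr_divide powr_minus powr_realpow[symmetric] powr_powr field_simps)
    also have "\<dots> \<le> \<bar>u - v\<bar> powr (- \<beta>)"
      using golden_digit_agree_imp_close[of k u v] c0 \<beta> uv by (intro powr_mono2') (auto simp: c_def frac)
    finally show ?thesis using assms(2) by (simp add: mult_left_mono mult.assoc)
  qed
  finally show ?thesis by (simp add: ennreal_leI)
qed

lemma nn_integral_abs_powr_le:
  assumes "0 \<le> \<beta>" "\<beta> < 1" "0 \<le> u" "u \<le> 1"
  shows "(\<integral>\<^sup>+v. ennreal (\<bar>u - v\<bar> powr (- \<beta>)) \<partial>unit_uniform) \<le> ennreal (2 / (1 - \<beta>))"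
proof -
  let ?f = "\<lambda>w::real. ennreal (w powr (- \<beta>)) * indicator {0..1} w"
  have int: "(\<integral>\<^sup>+w. ?f w \<partial>lborel) = ennreal (1 / (1 - \<beta>))"
    using nn_integral_unit_powr[of "- \<beta>"] assms by (simp add: add.commute)
  have "(\<integral>\<^sup>+v. ennreal (\<bar>u - v\<bar> powr (- \<beta>)) \<partial>unit_uniform)
      = (\<integral>\<^sup>+v. ennreal (\<bar>u - v\<bar> powr (- \<beta>)) * indicator {0..1} v \<partial>lborel)"
    by (rule nn_integral_unit_uniform) measurable
  also have "\<dots> \<le> (\<integral>\<^sup>+v. ?f (u + (-1) * v) + ?f (- u + 1 * v) \<partial>lborel)"
    using assms by (intro nn_integral_mono) (auto simp: indicator_def abs_if)
  also have "\<dots> = (\<integral>\<^sup>+v. ?f (u + (-1) * v) \<partial>lborel) + (\<integral>\<^sup>+v. ?f (- u + 1 * v) \<partial>lborel)"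
    by (rule nn_integral_add) measurable
  also have "(\<integral>\<^sup>+v. ?f (u + (-1) * v) \<partial>lborel) = (\<integral>\<^sup>+w. ?f w \<partial>lborel)"
    using nn_integral_real_affine[of ?f "-1" u] by simp
  also have "(\<integral>\<^sup>+v. ?f (- u + 1 * v) \<partial>lborel) = (\<integral>\<^sup>+w. ?f w \<partial>lborel)"
    using nn_integral_real_affine[of ?f 1 "- u"] by simp
  finally show ?thesis using assms by (simp only: int) (simp flip: ennreal_plus)
qed

lemma correlation_measurable [measurable]:
  "(\<lambda>y. correlation y r) \<in> borel_measurable (ratio_space \<theta>)"
proof -
  interpret U: prob_space unit_uniform by (rule prob_space_unit_uniform)
  interpret UU: pair_prob_space unit_uniform unit_uniform ..
  let ?E = "{x \<in> space (ratio_space \<theta> \<Otimes>\<^sub>M (unit_uniform \<Otimes>\<^sub>M unit_uniform)).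
     \<bar>golden_projection (fst x) (fst (snd x)) - golden_projection (fst x) (snd (snd x))\<bar> \<le> r}"
  have "?E \<in> sets (ratio_space \<theta> \<Otimes>\<^sub>M (unit_uniform \<Otimes>\<^sub>M unit_uniform))" by measurable
  from UU.measurable_emeasure_Pair[OF this] show ?thesis
    by (simp add: correlation_def space_pair_measure vimage_def)
qed

text \<open>
  Exchange the integrals over the ratios and over \<open>u\<close> and \<open>v\<close>; the condition \<open>\<eta>\<^sup>s \<tau> > 1\<close> makes the
  remaining kernel \<open>\<bar>u - v\<bar>\<^sup>-\<^sup>\<beta>\<close> integrable.
\<close>
lemma expected_correlation_bound:
  assumes "0 < \<theta>" and \<delta>: "0 < \<delta>" "\<delta> < 1" and "0 < \<eta>" "\<eta> < 1" "0 < C"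
    and s: "0 < s" "s \<le> 1" "1 < \<eta> powr s * golden"
  obtains K where "0 \<le> K" "\<And>r. 0 < r \<Longrightarrow>
    (\<integral>\<^sup>+y. indicator (regular_ratios \<delta> \<eta> C) y * correlation y r \<partial>ratio_space \<theta>) \<le> ennreal (K * r powr s)"
proof -
  obtain B where B: "1 \<le> B"
    "\<And>w \<rho>. 0 < \<rho> \<Longrightarrow> emeasure (power_uniform_law \<theta>) {t. \<bar>1 + t * w\<bar> \<le> \<rho>} \<le> ennreal (B * \<rho>)"
    using power_uniform_law_affine_small_ball[OF assms(1)] by blast
  \<comment> \<open>The exponent for which \<open>\<eta>\<^sup>-\<^sup>s = \<tau>\<^sup>\<beta>\<close>.\<close>
  define \<beta> where "\<beta> = - s * ln \<eta> / ln golden"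
  have \<beta>: "0 \<le> \<beta>" "\<beta> < 1" "\<eta> powr (- s) = golden powr \<beta>"
  proof -
    show "0 \<le> \<beta>" using s assms ln_golden_pos by (simp add: \<beta>_def divide_nonpos_pos mult_nonneg_nonpos)
    have "0 < ln (\<eta> powr s * golden)" using s by simp
    then have "0 < s * ln \<eta> + ln golden" using assms golden_bounds by (simp add: ln_mult)
    then show "\<beta> < 1" using ln_golden_pos by (simp add: \<beta>_def field_simps)
    show "\<eta> powr (- s) = golden powr \<beta>"
      using assms golden_bounds ln_golden_pos by (simp add: powr_def \<beta>_def)
  qed
  define K where "K = B * C powr s * (2 / (1 - \<beta>))"
  interpret U: prob_space unit_uniform by (rule prob_space_unit_uniform)
  interpret UU: pair_prob_space unit_uniform unit_uniform ..
  interpret R: prob_space "ratio_space \<theta>" by (rule prob_space_ratio_space)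
  interpret RUU: pair_sigma_finite "ratio_space \<theta>" "unit_uniform \<Otimes>\<^sub>M unit_uniform" ..
  have "(\<integral>\<^sup>+y. indicator (regular_ratios \<delta> \<eta> C) y * correlation y r \<partial>ratio_space \<theta>) \<le> ennreal (K * r powr s)"
    if r: "0 < r" for r
  proof -
    define E where "E = {x \<in> space (ratio_space \<theta> \<Otimes>\<^sub>M (unit_uniform \<Otimes>\<^sub>M unit_uniform)).
       fst x \<in> regular_ratios \<delta> \<eta> C \<and>
       \<bar>golden_projection (fst x) (fst (snd x)) - golden_projection (fst x) (snd (snd x))\<bar> \<le> r}"
    have E: "E \<in> sets (ratio_space \<theta> \<Otimes>\<^sub>M (unit_uniform \<Otimes>\<^sub>M unit_uniform))"
      unfolding E_def by measurable
    have "(\<integral>\<^sup>+y. indicator (regular_ratios \<delta> \<eta> C) y * correlation y r \<partial>ratio_space \<theta>)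
        = (\<integral>\<^sup>+y. emeasure (unit_uniform \<Otimes>\<^sub>M unit_uniform) (Pair y -` E) \<partial>ratio_space \<theta>)"
      by (intro nn_integral_cong)
         (auto simp: E_def correlation_def space_pair_measure vimage_def indicator_def)
    also have "\<dots> = emeasure (ratio_space \<theta> \<Otimes>\<^sub>M (unit_uniform \<Otimes>\<^sub>M unit_uniform)) E"
      by (rule UU.emeasure_pair_measure_alt[OF E, symmetric])
    also have "\<dots> = (\<integral>\<^sup>+p. emeasure (ratio_space \<theta>) ((\<lambda>y. (y, p)) -` E) \<partial>(unit_uniform \<Otimes>\<^sub>M unit_uniform))"
      by (rule RUU.emeasure_pair_measure_alt2[OF E])
    also have "\<dots> = (\<integral>\<^sup>+u. \<integral>\<^sup>+v. emeasure (ratio_space \<theta>) ((\<lambda>y. (y, (u, v))) -` E) \<partial>unit_uniform \<partial>unit_uniform)"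
      by (rule U.nn_integral_fst[symmetric]) (rule RUU.measurable_emeasure_Pair2[OF E])
    also have "\<dots> \<le> (\<integral>\<^sup>+u. ennreal (K * r powr s) \<partial>unit_uniform)"
    proof (rule nn_integral_mono_AE)
      show "AE u in unit_uniform. (\<integral>\<^sup>+v. emeasure (ratio_space \<theta>) ((\<lambda>y. (y, (u, v))) -` E) \<partial>unit_uniform)
           \<le> ennreal (K * r powr s)"
        using AE_unit_uniform_range
      proof eventually_elim
        case u: (elim u)
        have "(\<integral>\<^sup>+v. emeasure (ratio_space \<theta>) ((\<lambda>y. (y, (u, v))) -` E) \<partial>unit_uniform)
            \<le> (\<integral>\<^sup>+v. ennreal (B * C powr s * r powr s * \<bar>u - v\<bar> powr (- \<beta>)) \<partial>unit_uniform)"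
        proof (rule nn_integral_mono_AE)
          show "AE v in unit_uniform. emeasure (ratio_space \<theta>) ((\<lambda>y. (y, (u, v))) -` E)
             \<le> ennreal (B * C powr s * r powr s * \<bar>u - v\<bar> powr (- \<beta>))"
            \<comment> \<open>The diagonal has to be left out, as \<open>0 powr (- \<beta>) = 0\<close> there.\<close>
            using AE_unit_uniform_range AE_unit_uniform_neq[of u]
          proof eventually_elim
            case (elim v)
            have "(\<lambda>y. (y, (u, v))) -` E
                = {y \<in> regular_ratios \<delta> \<eta> C. \<bar>golden_projection y u - golden_projection y v\<bar> \<le> r}"
              by (auto simp: E_def space_pair_measure)
            then show ?case
              using small_ball_two_points[OF B(2,1) \<delta> assms(4,6) r s(1,2) \<beta>(1) eq_refl[OF \<beta>(3)], of u v] u elim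
              by auto
          qed
        qed
        also have "\<dots> = ennreal (B * C powr s * r powr s) * (\<integral>\<^sup>+v. ennreal (\<bar>u - v\<bar> powr (- \<beta>)) \<partial>unit_uniform)"
          using B(1) by (subst nn_integral_cmult[symmetric]) (auto simp: ennreal_mult')
        also have "\<dots> \<le> ennreal (B * C powr s * r powr s) * ennreal (2 / (1 - \<beta>))"
          using u \<beta> by (intro mult_left_mono nn_integral_abs_powr_le) auto
        also have "\<dots> = ennreal (K * r powr s)"
          using B(1) \<beta> by (subst ennreal_mult[symmetric]) (auto simp: K_def)
        finally show ?case .
      qed
    qed
    also have "\<dots> = ennreal (K * r powr s)" by (simp add: U.emeasure_space_1)
    finally show ?thesis .
  qed
  moreover have "0 \<le> K" using B(1) \<beta> by (simp add: K_def)
  ultimately show ?thesis using that by blast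
qed

section \<open>Compactness and cylinder covers\<close>

definition golden_words :: "(nat \<Rightarrow> real) set" where
  "golden_words = {a. (\<forall>i. a i \<in> {0, 1}) \<and> (\<forall>i. a i * a (Suc i) = 0)}"

lemma golden_digit_word: "(\<lambda>i. golden_digit i u) \<in> golden_words"
  unfolding golden_words_def using golden_digit_binary golden_digit_admissible by blast

lemma golden_words_abs_le: "a \<in> golden_words \<Longrightarrow> \<bar>a i\<bar> \<le> 1"
  unfolding golden_words_def by (auto dest!: spec[of _ i])

lemma restricted_sums_eq_image:
  assumes "y \<in> regular_ratios \<delta> \<eta> C" "0 < \<delta>" "\<delta> < 1"
  shows "restricted_sums y = (\<lambda>a. \<Sum>i. a i * partial_prods y i) ` golden_words"
proof -
  have "(\<lambda>i. a i * partial_prods y i) sums x \<longleftrightarrow> x = (\<Sum>i. a i * partial_prods y i)"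
    if "a \<in> golden_words" for a x
    using summable_digit_series[OF assms golden_words_abs_le[OF that]] by (auto simp: sums_iff)
  moreover have "restricted_sums y = {x. \<exists>a\<in>golden_words. (\<lambda>i. a i * partial_prods y i) sums x}"
    unfolding restricted_sums_def golden_words_def by blast
  ultimately show ?thesis unfolding image_def by blast
qed

lemma golden_projection_in_restricted_sums:
  assumes "y \<in> regular_ratios \<delta> \<eta> C" "0 < \<delta>" "\<delta> < 1"
  shows "golden_projection y u \<in> restricted_sums y"
  unfolding restricted_sums_eq_image[OF assms] golden_projection_def
  by (rule image_eqI[OF refl golden_digit_word])

lemma compact_golden_words: "compact golden_words"
proof -
  have "compact (Pi\<^sub>E UNIV (\<lambda>_::nat. {0, 1::real}))"
    using compactin_PiE[of "\<lambda>_::nat. euclidean" UNIV "\<lambda>_. {0, 1::real}"]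
    by (simp add: euclidean_product_topology)
  moreover have "closed (\<Inter>i::nat. {a :: nat \<Rightarrow> real. a i * a (Suc i) = 0})"
    by (intro closed_INT ballI closed_Collect_eq continuous_intros continuous_on_product_coordinates)
  ultimately have "compact (Pi\<^sub>E UNIV (\<lambda>_::nat. {0, 1::real}) \<inter> (\<Inter>i. {a. a i * a (Suc i) = 0}))"
    by (rule compact_Int_closed)
  moreover have "golden_words = Pi\<^sub>E UNIV (\<lambda>_. {0, 1}) \<inter> (\<Inter>i. {a. a i * a (Suc i) = 0})"
    unfolding golden_words_def by auto
  ultimately show ?thesis by (simp only:)
qed

text \<open>
  A continuous image of the compact space of admissible words, the series converging uniformly on it.
  In particular the set is measurable.
\<close>
lemma compact_restricted_sums:
  assumes y: "y \<in> regular_ratios \<delta> \<eta> C" and \<delta>: "0 < \<delta>" "\<delta> < 1"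
  shows "compact (restricted_sums y)"
proof -
  have "uniform_limit golden_words (\<lambda>n a. \<Sum>i<n. a i * partial_prods y i)
          (\<lambda>a. \<Sum>i. a i * partial_prods y i) sequentially"
  proof (rule Weierstrass_m_test)
    show "summable (\<lambda>n. C * \<delta> ^ n)"
      using \<delta> by (intro summable_mult summable_geometric) simp
    fix n and a :: "nat \<Rightarrow> real" assume a: "a \<in> golden_words"
    have pos: "0 < partial_prods y n"
      using y by (intro partial_prods_pos) (auto simp: regular_ratios_def)
    have "\<bar>a n\<bar> * partial_prods y n \<le> 1 * partial_prods y n"
      using golden_words_abs_le[OF a] pos by (intro mult_right_mono) auto
    also have "\<dots> \<le> C * \<delta> ^ n" using y by (simp add: regular_ratios_def)
    finally show "norm (a n * partial_prods y n) \<le> C * \<delta> ^ n"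
      using pos by (simp add: abs_mult)
  qed
  then have "continuous_on golden_words (\<lambda>a. \<Sum>i. a i * partial_prods y i)"
  proof (rule uniform_limit_theorem[rotated])
    show "\<forall>\<^sub>F n in sequentially. continuous_on golden_words (\<lambda>a. \<Sum>i<n. a i * partial_prods y i)"
      by (intro always_eventually allI continuous_intros)
         (rule continuous_on_subset[OF continuous_on_product_coordinates], simp)
  qed simp
  then show ?thesis
    unfolding restricted_sums_eq_image[OF assms]
    by (rule compact_continuous_image) (rule compact_golden_words)
qed

definition truncated_sums :: "(nat \<Rightarrow> real) \<Rightarrow> nat \<Rightarrow> real set" where
  "truncated_sums y n = (\<lambda>a. \<Sum>i<n. a i * partial_prods y i) ` golden_words"

text \<open>
  A word of length \<open>n + 2\<close> ends in 0 and extends a word of length \<open>n + 1\<close>, or ends in 01 and extends a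
  word of length \<open>n\<close>. The bound follows this Fibonacci recursion because \<open>\<tau>\<^sup>2 = \<tau> + 1\<close>, and the exponent
  \<open>n + 1\<close> makes it hold at the start, where the counts are 1 and 2.
\<close>
lemma truncated_sums_card:
  "finite (truncated_sums y n) \<and> real (card (truncated_sums y n)) \<le> golden ^ Suc n"
proof (induction n rule: induct_nat_012)
  case 0
  have "truncated_sums y 0 \<subseteq> {0}" by (auto simp: truncated_sums_def)
  then have "finite (truncated_sums y 0)" "card (truncated_sums y 0) \<le> 1"
    using card_mono[of "{0::real}" "truncated_sums y 0"] finite_subset by auto
  then show ?case using golden_bounds by auto
next
  case 1
  have "truncated_sums y (Suc 0) \<subseteq> {0, partial_prods y 0}"
    by (auto simp: truncated_sums_def golden_words_def)
  then have "finite (truncated_sums y (Suc 0))" "card (truncated_sums y (Suc 0)) \<le> card {0, partial_prods y 0}"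
    using card_mono[of "{0, partial_prods y 0}" "truncated_sums y (Suc 0)"] finite_subset by auto
  moreover have "card {0, partial_prods y 0} \<le> 2" by (simp add: card_insert_if)
  ultimately show ?case using golden_bounds golden_square by auto
next
  case (ge2 n)
  let ?T = "truncated_sums y" and ?x = "partial_prods y (Suc n)"
  have sub: "?T (Suc (Suc n)) \<subseteq> ?T (Suc n) \<union> (\<lambda>t. t + ?x) ` ?T n"
  proof
    fix z assume "z \<in> ?T (Suc (Suc n))"
    then obtain a where a: "a \<in> golden_words" and z: "z = (\<Sum>i<Suc (Suc n). a i * partial_prods y i)"
      by (auto simp: truncated_sums_def)
    show "z \<in> ?T (Suc n) \<union> (\<lambda>t. t + ?x) ` ?T n"
    proof (cases "a (Suc n) = 0")
      case True
      then have "z = (\<Sum>i<Suc n. a i * partial_prods y i)" using z by simp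
      then show ?thesis using a by (auto simp: truncated_sums_def simp del: sum.lessThan_Suc)
    next
      case False
      then have "a (Suc n) = 1" "a n = 0" using a by (auto simp: golden_words_def)
      then have "z = (\<Sum>i<n. a i * partial_prods y i) + ?x" using z by simp
      then show ?thesis using a by (auto simp: truncated_sums_def)
    qed
  qed
  have fin: "finite (?T (Suc n) \<union> (\<lambda>t. t + ?x) ` ?T n)" using ge2 by simp
  have "card (?T (Suc (Suc n))) \<le> card (?T (Suc n) \<union> (\<lambda>t. t + ?x) ` ?T n)"
    by (rule card_mono[OF fin sub])
  also have "\<dots> \<le> card (?T (Suc n)) + card ((\<lambda>t. t + ?x) ` ?T n)" by (rule card_Un_le)
  also have "\<dots> \<le> card (?T (Suc n)) + card (?T n)" using ge2 by (simp add: card_image_le)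
  finally have "real (card (?T (Suc (Suc n)))) \<le> golden ^ Suc (Suc n) + golden ^ Suc n" using ge2 by linarith
  also have "\<dots> = golden ^ Suc n * (golden + 1)" by (simp add: algebra_simps)
  also have "\<dots> = golden ^ Suc (Suc (Suc n))" by (simp add: golden_square[symmetric])
  finally show ?case using finite_subset[OF sub fin] by simp
qed

text \<open>
  The part of a series beyond index \<open>n\<close> is dominated by a geometric one.
\<close>
lemma restricted_sums_cover:
  assumes y: "y \<in> regular_ratios \<delta> \<eta> C" and \<delta>: "0 < \<delta>" "\<delta> < 1"
  shows "restricted_sums y \<subseteq> (\<Union>t\<in>truncated_sums y n. {t..t + C / (1 - \<delta>) * \<delta> ^ n})"
proof
  fix x assume "x \<in> restricted_sums y"
  then obtain a where a: "a \<in> golden_words" and x: "x = (\<Sum>i. a i * partial_prods y i)"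
    unfolding restricted_sums_eq_image[OF assms] by auto
  let ?f = "\<lambda>i. a i * partial_prods y i"
  have pos: "0 < partial_prods y n" for n
    using y by (intro partial_prods_pos) (auto simp: regular_ratios_def)
  have a01: "0 \<le> a i" "a i \<le> 1" for i
    using a unfolding golden_words_def by (auto dest!: spec[of _ i])
  have sm: "summable ?f" by (rule summable_digit_series[OF assms golden_words_abs_le[OF a]])
  have sm': "summable (\<lambda>i. ?f (i + n))" using sm by (rule summable_ignore_initial_segment)
  have geo: "(\<lambda>i. C * \<delta> ^ n * \<delta> ^ i) sums (C * \<delta> ^ n * (1 / (1 - \<delta>)))"
    using \<delta> by (intro sums_mult geometric_sums) simp
  have "x = (\<Sum>i. ?f (i + n)) + (\<Sum>i<n. ?f i)"
    unfolding x by (rule suminf_split_initial_segment[OF sm])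
  moreover have "0 \<le> (\<Sum>i. ?f (i + n))"
    using a01 pos by (intro suminf_nonneg[OF sm']) (simp add: less_imp_le)
  moreover have "(\<Sum>i. ?f (i + n)) \<le> (\<Sum>i. C * \<delta> ^ n * \<delta> ^ i)"
  proof (rule suminf_le[OF _ sm' sums_summable[OF geo]])
    fix i
    have "?f (i + n) \<le> 1 * partial_prods y (i + n)"
      using a01 pos by (intro mult_right_mono) (auto intro: less_imp_le)
    also have "\<dots> \<le> C * \<delta> ^ (i + n)" using y by (simp add: regular_ratios_def)
    finally show "?f (i + n) \<le> C * \<delta> ^ n * \<delta> ^ i" by (simp add: power_add mult_ac)
  qed
  moreover have "(\<Sum>i. C * \<delta> ^ n * \<delta> ^ i) = C / (1 - \<delta>) * \<delta> ^ n"
    using sums_unique[OF geo] by simp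
  ultimately have "x \<in> {(\<Sum>i<n. ?f i)..(\<Sum>i<n. ?f i) + C / (1 - \<delta>) * \<delta> ^ n}" by simp
  then show "x \<in> (\<Union>t\<in>truncated_sums y n. {t..t + C / (1 - \<delta>) * \<delta> ^ n})"
    using a unfolding truncated_sums_def by blast
qed

lemma hausdorff_premeasure_le_finite_intervals:
  fixes A :: "real set"
  assumes "finite T" "A \<subseteq> (\<Union>t\<in>T. {t..t + h})" "0 \<le> h" "h \<le> d" "0 < s"
  shows "hausdorff_premeasure s d A \<le> ennreal (real (card T) * h powr s)"
proof -
  obtain e where e: "bij_betw e {0..<card T} T" using ex_bij_betw_nat_finite[OF assms(1)] by blast
  define B where "B i = (if i < card T then {e i..e i + h} else {})" for i
  have diam: "diameter {x..x + h} = h" for x using assms(3) by (simp add: diameter_closed_interval)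
  have "hausdorff_premeasure s d A \<le> (\<Sum>i. diameter_power s (B i))"
    unfolding hausdorff_premeasure_def
  proof (rule INF_lower, safe)
    fix x assume "x \<in> A"
    then obtain t where "t \<in> T" "x \<in> {t..t + h}" using assms(2) by blast
    then have "t \<in> e ` {0..<card T}" using bij_betw_imp_surj_on[OF e] by simp
    then obtain i where "i < card T" "e i = t" by auto
    then show "x \<in> (\<Union>i. B i)" using \<open>x \<in> {t..t + h}\<close> unfolding B_def by auto
  next
    show "bounded (B i)" "diameter (B i) \<le> d" for i using assms diam by (auto simp: B_def)
  qed
  also have "\<dots> = (\<Sum>i<card T. diameter_power s (B i))"
    by (rule suminf_finite) (auto simp: B_def diameter_power_def)
  also have "\<dots> = (\<Sum>i<card T. ennreal (h powr s))"
    using assms(3,5) diam by (intro sum.cong) (auto simp: B_def diameter_power_def)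
  also have "\<dots> = ennreal (real (card T) * h powr s)"
    by (simp add: ennreal_of_nat_eq_real_of_nat ennreal_mult')
  finally show ?thesis .
qed

lemma hausdorff_measure_restricted_sums_zero:
  assumes y: "y \<in> regular_ratios \<delta> \<eta> C" and \<delta>: "0 < \<delta>" "\<delta> < 1" and "0 < C" "0 < s" "\<delta> powr s * golden < 1"
  shows "hausdorff_measure s (restricted_sums y) = 0"
proof -
  define R where "R = C / (1 - \<delta>)"
  have R: "0 < R" using assms by (simp add: R_def)
  note cover = restricted_sums_cover[OF y \<delta>, folded R_def]
  have "hausdorff_premeasure s d (restricted_sums y) \<le> 0" if "0 < d" for d
  proof (rule ennreal_le_epsilon)
    fix \<epsilon> :: real assume \<epsilon>: "0 < \<epsilon>"
    have "(\<lambda>n. R * \<delta> ^ n) \<longlonglongrightarrow> R * 0"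
      using \<delta> by (intro tendsto_intros LIMSEQ_realpow_zero) auto
    then have 1: "\<forall>\<^sub>F n in sequentially. R * \<delta> ^ n < d" using that by (intro order_tendstoD) auto
    have "(\<lambda>n. golden * R powr s * (\<delta> powr s * golden) ^ n) \<longlonglongrightarrow> golden * R powr s * 0"
      using assms golden_bounds by (intro tendsto_intros LIMSEQ_realpow_zero) auto
    then have 2: "\<forall>\<^sub>F n in sequentially. golden * R powr s * (\<delta> powr s * golden) ^ n < \<epsilon>"
      using \<epsilon> by (intro order_tendstoD) auto
    obtain n where n: "R * \<delta> ^ n < d" "golden * R powr s * (\<delta> powr s * golden) ^ n < \<epsilon>"
      using eventually_happens[OF eventually_conj[OF 1 2]] by auto
    have T: "finite (truncated_sums y n)" "real (card (truncated_sums y n)) \<le> golden ^ Suc n"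
      using truncated_sums_card by auto
    have "hausdorff_premeasure s d (restricted_sums y)
        \<le> ennreal (real (card (truncated_sums y n)) * (R * \<delta> ^ n) powr s)"
      using n R \<delta> assms
      by (intro hausdorff_premeasure_le_finite_intervals[OF T(1) cover]) auto
    also have "\<dots> \<le> ennreal (golden ^ Suc n * (R * \<delta> ^ n) powr s)"
      using T(2) by (intro ennreal_leI mult_right_mono) auto
    also have "golden ^ Suc n * (R * \<delta> ^ n) powr s = golden * R powr s * (\<delta> powr s * golden) ^ n"
    proof -
      have "(R * \<delta> ^ n) powr s = R powr s * (\<delta> powr s) ^ n"
        using \<delta> by (simp add: powr_mult powr_realpow[symmetric] powr_powr mult.commute)
      then show ?thesis by (simp add: power_mult_distrib mult_ac)
    qed
    finally show "hausdorff_premeasure s d (restricted_sums y) \<le> 0 + ennreal \<epsilon>"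
      using n(2) \<epsilon> by (simp add: ennreal_leI order_trans[of _ "ennreal _"])
  qed
  then have "hausdorff_measure s (restricted_sums y) \<le> 0"
    unfolding hausdorff_measure_def by (intro SUP_least) auto
  then show ?thesis by simp
qed

lemma restricted_sums_null_set:
  assumes y: "y \<in> regular_ratios \<delta> \<eta> C" and \<delta>: "0 < \<delta>" "\<delta> < 1" and "0 < C" "\<delta> * golden < 1"
  shows "restricted_sums y \<in> null_sets lebesgue"
proof -
  define R where "R = C / (1 - \<delta>)"
  define N where "N = (\<Inter>n. \<Union>t\<in>truncated_sums y n. {t..t + R * \<delta> ^ n})"
  have R: "0 < R" using assms by (simp add: R_def)
  note cover = restricted_sums_cover[OF y \<delta>, folded R_def]
  have T: "finite (truncated_sums y n)" "real (card (truncated_sums y n)) \<le> golden ^ Suc n" for n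
    using truncated_sums_card by auto
  have cover_sets: "(\<Union>t\<in>truncated_sums y n. {t..t + R * \<delta> ^ n}) \<in> sets borel" for n
    using T(1) by (intro sets.finite_UN) auto
  have N: "N \<in> sets borel" unfolding N_def using cover_sets by (intro sets.countable_INT) auto
  have "emeasure lborel N \<le> ennreal (golden * R * (\<delta> * golden) ^ n)" for n
  proof -
    have "emeasure lborel N \<le> emeasure lborel (\<Union>t\<in>truncated_sums y n. {t..t + R * \<delta> ^ n})"
      using cover_sets[of n] by (intro emeasure_mono) (auto simp: N_def)
    also have "\<dots> \<le> (\<Sum>t\<in>truncated_sums y n. emeasure lborel {t..t + R * \<delta> ^ n})"
      using T(1) by (intro emeasure_subadditive_finite) auto
    also have "\<dots> = ennreal (real (card (truncated_sums y n)) * (R * \<delta> ^ n))"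
      using R \<delta> by (simp add: ennreal_of_nat_eq_real_of_nat ennreal_mult')
    also have "\<dots> \<le> ennreal (golden ^ Suc n * (R * \<delta> ^ n))"
      using T(2)[of n] R \<delta> by (intro ennreal_leI mult_right_mono) auto
    also have "golden ^ Suc n * (R * \<delta> ^ n) = golden * R * (\<delta> * golden) ^ n"
      by (simp add: power_mult_distrib mult_ac)
    finally show ?thesis .
  qed
  moreover have "(\<lambda>n. ennreal (golden * R * (\<delta> * golden) ^ n)) \<longlonglongrightarrow> ennreal (golden * R * 0)"
    using assms golden_bounds by (intro tendsto_intros LIMSEQ_realpow_zero tendsto_ennrealI) auto
  ultimately have "emeasure lborel N \<le> ennreal (golden * R * 0)"
    by (intro tendsto_lowerbound[where F = sequentially]) auto
  then have "N \<in> null_sets lborel" using N by (simp add: null_sets_def)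
  moreover have "restricted_sums y \<subseteq> N" unfolding N_def using cover by blast
  ultimately show ?thesis unfolding null_sets_completion_iff2 by blast
qed

section \<open>The mass distribution principle\<close>

text \<open>
  On regular ratios the terms have expectation \<open>O(2 powr ((s' - s) j))\<close>, which is summable.
\<close>
lemma AE_correlation_series_finite:
  assumes "0 < \<theta>" and \<delta>: "0 < \<delta>" "\<delta> < 1" and "0 < \<eta>" "\<eta> < 1" "0 < C"
    and s: "0 < s" "s \<le> 1" "1 < \<eta> powr s * golden" and "s' < s"
  shows "AE y in ratio_space \<theta>. y \<in> regular_ratios \<delta> \<eta> C \<longrightarrow>
    (\<Sum>j. ennreal ((2 powr s') ^ j) * correlation y ((1/2) ^ j)) \<noteq> \<infinity>"
proof -
  obtain K where K: "0 \<le> K" "\<And>r. 0 < r \<Longrightarrow>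
    (\<integral>\<^sup>+y. indicator (regular_ratios \<delta> \<eta> C) y * correlation y r \<partial>ratio_space \<theta>) \<le> ennreal (K * r powr s)"
    using expected_correlation_bound[OF assms(1-9)] by blast
  let ?f = "\<lambda>j y. ennreal ((2 powr s') ^ j) * (indicator (regular_ratios \<delta> \<eta> C) y * correlation y ((1/2) ^ j))"
  define q where "q = 2 powr (s' - s)"
  have q: "0 < q" "q < 1" using assms(10) by (auto simp: q_def powr_less_one)
  have "(\<integral>\<^sup>+y. (\<Sum>j. ?f j y) \<partial>ratio_space \<theta>) = (\<Sum>j. \<integral>\<^sup>+y. ?f j y \<partial>ratio_space \<theta>)"
    by (rule nn_integral_suminf) measurable
  also have "\<dots> \<le> (\<Sum>j. ennreal (K * q ^ j))"
  proof (rule suminf_le)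
    fix j
    have "(\<integral>\<^sup>+y. ?f j y \<partial>ratio_space \<theta>)
       = ennreal ((2 powr s') ^ j) * (\<integral>\<^sup>+y. indicator (regular_ratios \<delta> \<eta> C) y * correlation y ((1/2) ^ j) \<partial>ratio_space \<theta>)"
      by (rule nn_integral_cmult) measurable
    also have "\<dots> \<le> ennreal ((2 powr s') ^ j) * ennreal (K * ((1/2) ^ j) powr s)"
      by (intro mult_left_mono K) auto
    also have "\<dots> = ennreal ((2 powr s') ^ j * (K * ((1/2) ^ j) powr s))"
      using K(1) by (simp add: ennreal_mult)
    also have "(2 powr s') ^ j * (K * ((1/2) ^ j) powr s) = K * q ^ j"
    proof -
      have "((1/2) ^ j) powr s = ((1/2) powr s) ^ j"
        by (simp add: powr_realpow[symmetric] powr_powr mult.commute)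
      also have "(1/2) powr s = 2 powr (- s)" by (simp add: powr_minus powr_divide field_simps)
      finally have "(2 powr s') ^ j * ((1/2) ^ j) powr s = (2 powr s' * 2 powr (- s)) ^ j"
        by (simp only: power_mult_distrib)
      also have "2 powr s' * 2 powr (- s) = q" by (simp add: q_def powr_add[symmetric])
      finally show ?thesis by simp
    qed
    finally show "(\<integral>\<^sup>+y. ?f j y \<partial>ratio_space \<theta>) \<le> ennreal (K * q ^ j)" .
  qed auto
  also have "\<dots> < \<infinity>"
  proof -
    have "summable (\<lambda>j. K * q ^ j)" using q by (intro summable_mult summable_geometric) simp
    then show ?thesis using q K(1) by (subst suminf_ennreal2) auto
  qed
  finally have "(\<integral>\<^sup>+y. (\<Sum>j. ?f j y) \<partial>ratio_space \<theta>) \<noteq> \<infinity>" by (simp only: less_top infinity_ennreal_def)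
  then have "AE y in ratio_space \<theta>. (\<Sum>j. ?f j y) \<noteq> \<infinity>"
    by (intro nn_integral_PInf_AE) measurable
  then show ?thesis by eventually_elim auto
qed

lemma hausdorff_measure_mono_exponent:
  assumes "0 \<le> s" "s \<le> t" "hausdorff_measure s A = 0"
  shows "hausdorff_measure t A = 0"
proof -
  have mono: "diameter_power t B \<le> diameter_power s B" if "bounded B" "diameter B \<le> 1" for B :: "'a set"
  proof -
    have "0 \<le> diameter B" using that(1) by (rule diameter_ge_0)
    then have "s \<noteq> 0 \<Longrightarrow> diameter B powr t \<le> diameter B powr s"
      using that assms by (cases "diameter B = 0") (auto intro: powr_mono')
    moreover have "diameter B powr t \<le> 1" using \<open>0 \<le> diameter B\<close> that assms by (intro powr_le1) auto
    ultimately show ?thesis using assms by (auto simp: diameter_power_def ennreal_leI)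
  qed
  have "hausdorff_premeasure t d A \<le> 0" if "0 < d" for d
  proof -
    have "hausdorff_premeasure t d A \<le> hausdorff_premeasure s (min d 1) A"
      unfolding hausdorff_premeasure_def
    proof (rule INF_mono)
      fix B :: "nat \<Rightarrow> 'a set"
      assume B: "B \<in> {C. A \<subseteq> (\<Union>i. C i) \<and> (\<forall>i. bounded (C i) \<and> diameter (C i) \<le> min d 1)}"
      then have "(\<Sum>i. diameter_power t (B i)) \<le> (\<Sum>i. diameter_power s (B i))"
        by (intro suminf_le mono) auto
      then show "\<exists>C\<in>{C. A \<subseteq> (\<Union>i. C i) \<and> (\<forall>i. bounded (C i) \<and> diameter (C i) \<le> d)}.
          (\<Sum>i. diameter_power t (C i)) \<le> (\<Sum>i. diameter_power s (B i))"
        using B by (intro bexI[of _ B]) auto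
    qed
    also have "\<dots> \<le> hausdorff_measure s A"
      unfolding hausdorff_measure_def using that by (intro SUP_upper) auto
    finally show ?thesis using assms(3) by simp
  qed
  then have "hausdorff_measure t A \<le> 0"
    unfolding hausdorff_measure_def by (intro SUP_least) auto
  then show ?thesis by simp
qed

lemma dyadic_scale:
  fixes d :: real
  assumes "0 < d" "d \<le> 1"
  obtains j where "d \<le> (1/2) ^ j" "(1/2) ^ j < 2 * d"
proof -
  have "\<exists>n. (1/2) ^ n < d" using assms by (intro real_arch_pow_inv) auto
  define n where "n = (LEAST n. (1/2) ^ n < d)"
  have n: "(1/2) ^ n < d" unfolding n_def using \<open>\<exists>n. (1/2) ^ n < d\<close> by (rule LeastI_ex)
  then have "n \<noteq> 0" using assms by (cases n) auto
  then obtain j where j: "n = Suc j" by (cases n) auto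
  have "\<not> (1/2) ^ j < d" using not_less_Least[of j "\<lambda>n. (1/2) ^ n < d"] j by (simp add: n_def)
  moreover have "(1/2) ^ j < 2 * d" using n j by simp
  ultimately show ?thesis using that[of j] by simp
qed

text \<open>
  The mass distribution principle. Finiteness of the series means that on some set \<open>B\<close> of positive
  measure every point \<open>u\<close> sees mass at most \<open>const \<cdot> 2\<^sup>-\<^sup>j\<^sup>s\<close> within distance \<open>2\<^sup>-\<^sup>j\<close> of its projection.
  A covering set that meets the projection of \<open>B\<close> therefore carries mass at most a constant times its
  diameter to the power \<open>s\<close>, and the masses add up to at least that of \<open>B\<close>.
\<close>
lemma hausdorff_measure_pos_of_correlation:
  assumes y: "y \<in> regular_ratios \<delta> \<eta> C" and \<delta>: "0 < \<delta>" "\<delta> < 1" and s: "0 < s"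
    and fin: "(\<Sum>j. ennreal ((2 powr s) ^ j) * correlation y ((1/2) ^ j)) \<noteq> \<infinity>"
  shows "hausdorff_measure s (restricted_sums y) \<noteq> 0"
proof
  assume zero: "hausdorff_measure s (restricted_sums y) = 0"
  interpret U: prob_space unit_uniform by (rule prob_space_unit_uniform)
  let ?\<pi> = "golden_projection y"
  define f where "f j u = emeasure unit_uniform {v. \<bar>?\<pi> u - ?\<pi> v\<bar> \<le> (1/2) ^ j}" for j :: nat and u
  define G where "G u = (\<Sum>j. ennreal ((2 powr s) ^ j) * f j u)" for u
  have D: "{p. \<bar>?\<pi> (fst p) - ?\<pi> (snd p)\<bar> \<le> r} \<in> sets (unit_uniform \<Otimes>\<^sub>M unit_uniform)" for r
  proof -
    have "Measurable.pred (unit_uniform \<Otimes>\<^sub>M unit_uniform) (\<lambda>p. \<bar>?\<pi> (fst p) - ?\<pi> (snd p)\<bar> \<le> r)" by measurable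
    then show ?thesis by (simp add: pred_def space_pair_measure)
  qed
  have f_eq: "f j u = emeasure unit_uniform (Pair u -` {p. \<bar>?\<pi> (fst p) - ?\<pi> (snd p)\<bar> \<le> (1/2) ^ j})" for j u
    by (simp add: f_def vimage_def)
  have [measurable]: "f j \<in> borel_measurable borel" for j
    using U.measurable_emeasure_Pair[OF D[of "(1/2) ^ j"]] unfolding f_eq[abs_def] by simp
  have [measurable]: "G \<in> borel_measurable borel" unfolding G_def[abs_def] by measurable
  have "(\<integral>\<^sup>+u. G u \<partial>unit_uniform) = (\<Sum>j. \<integral>\<^sup>+u. ennreal ((2 powr s) ^ j) * f j u \<partial>unit_uniform)"
    unfolding G_def by (rule nn_integral_suminf) measurable
  also have "\<dots> = (\<Sum>j. ennreal ((2 powr s) ^ j) * correlation y ((1/2) ^ j))"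
    unfolding correlation_def U.emeasure_pair_measure_alt[OF D] f_eq[symmetric]
    by (intro suminf_cong nn_integral_cmult) measurable
  finally have "(\<integral>\<^sup>+u. G u \<partial>unit_uniform) \<noteq> \<infinity>" using fin by simp
  then have "AE u in unit_uniform. G u \<noteq> \<infinity>" by (intro nn_integral_PInf_AE) measurable
  have "\<exists>n::nat. emeasure unit_uniform {u. G u \<le> of_nat n} \<noteq> 0"
  proof (rule ccontr)
    assume "\<nexists>n::nat. emeasure unit_uniform {u. G u \<le> of_nat n} \<noteq> 0"
    then have "AE u in unit_uniform. \<not> G u \<le> of_nat n" for n :: nat
      by (intro AE_I[of _ _ "{u. G u \<le> of_nat n}"]) auto
    then have "AE u in unit_uniform. \<forall>n::nat. \<not> G u \<le> of_nat n" by (simp add: AE_all_countable)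
    then have "AE u in unit_uniform. False" using \<open>AE u in unit_uniform. G u \<noteq> \<infinity>\<close>
    proof eventually_elim
      case (elim u)
      then obtain x where "G u = ennreal x" "0 \<le> x" by (cases "G u") auto
      moreover obtain n :: nat where "x \<le> real n" using real_arch_simple by blast
      ultimately have "G u \<le> of_nat n" by (simp add: ennreal_of_nat_eq_real_of_nat ennreal_leI)
      then show ?case using elim by blast
    qed
    then show False by simp
  qed
  then obtain n :: nat where n: "emeasure unit_uniform {u. G u \<le> of_nat n} \<noteq> 0" by blast
  define B where "B = {u. G u \<le> of_nat n}"
  \<comment> \<open>The factor \<open>2 powr s\<close> pays for rounding a diameter up to a dyadic scale.\<close>
  define K where "K = real (Suc n) * 2 powr s"
  have K: "0 < K" by (simp add: K_def)
  have B: "B \<in> sets borel" unfolding B_def by measurable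
  define b where "b = measure unit_uniform B"
  have b: "emeasure unit_uniform B = ennreal b" "0 < b"
  proof -
    show eq: "emeasure unit_uniform B = ennreal b" unfolding b_def by (rule U.emeasure_eq_measure)
    have "ennreal b \<noteq> 0" using n unfolding eq[symmetric] B_def .
    then show "0 < b" by (simp add: ennreal_eq_0_iff)
  qed
  have fB: "f j u \<le> ennreal (real (Suc n) * ((1/2) ^ j) powr s)" if "u \<in> B" for j u
  proof -
    have "ennreal ((2 powr s) ^ j) * f j u \<le> G u"
      using sum_le_suminf[of "\<lambda>j. ennreal ((2 powr s) ^ j) * f j u" "{j}"] by (simp add: G_def)
    also have "\<dots> \<le> ennreal (real (Suc n))"
      using that by (simp add: B_def ennreal_of_nat_eq_real_of_nat) (auto intro: order_trans ennreal_leI)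
    finally have le: "ennreal ((2 powr s) ^ j) * f j u \<le> ennreal (real (Suc n))" .
    have "f j u = ennreal (((1/2) ^ j) powr s) * (ennreal ((2 powr s) ^ j) * f j u)"
    proof -
      have "((1/2) ^ j) powr s * (2 powr s) ^ j = 1"
        by (simp add: powr_realpow[symmetric] powr_powr powr_mult[symmetric] mult.commute powr_divide)
      then have "ennreal (((1/2) ^ j) powr s) * ennreal ((2 powr s) ^ j) = 1"
        by (simp add: ennreal_mult[symmetric])
      then show ?thesis by (simp add: mult.assoc[symmetric])
    qed
    also have "\<dots> \<le> ennreal (((1/2) ^ j) powr s) * ennreal (real (Suc n))"
      using le by (intro mult_left_mono) auto
    also have "\<dots> = ennreal (real (Suc n) * ((1/2) ^ j) powr s)"
      by (subst ennreal_mult[symmetric]) (simp_all add: mult.commute del: of_nat_Suc)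
    finally show ?thesis .
  qed
  have mass: "\<exists>D \<in> sets borel. {u \<in> B. ?\<pi> u \<in> X} \<subseteq> D \<and> emeasure unit_uniform D \<le> ennreal K * diameter_power s X"
    if X: "bounded X" "diameter X \<le> 1" for X
  proof (cases "{u \<in> B. ?\<pi> u \<in> X} = {}")
    case True
    then show ?thesis by (intro bexI[of _ "{}"]) auto
  next
    case False
    then obtain u where u: "u \<in> B" "?\<pi> u \<in> X" by auto
    define D where "D = {v. \<bar>?\<pi> u - ?\<pi> v\<bar> \<le> diameter X}"
    have D: "D \<in> sets borel" unfolding D_def by measurable
    have sub: "{u \<in> B. ?\<pi> u \<in> X} \<subseteq> D"
      using diameter_bounded_bound[OF X(1) u(2)] by (auto simp: D_def dist_real_def)
    have le: "emeasure unit_uniform D \<le> ennreal (real (Suc n) * ((1/2) ^ j) powr s)" if "diameter X \<le> (1/2) ^ j" for j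
    proof -
      have "{v. \<bar>?\<pi> u - ?\<pi> v\<bar> \<le> (1/2) ^ j} \<in> sets borel" by measurable
      then have "emeasure unit_uniform D \<le> f j u"
        unfolding f_def using that by (intro emeasure_mono) (auto simp: D_def)
      then show ?thesis using fB[OF u(1)] order_trans by blast
    qed
    have "emeasure unit_uniform D \<le> ennreal (K * diameter X powr s)"
    proof (cases "diameter X = 0")
      case True
      \<comment> \<open>A single point has no mass, being covered at every scale.\<close>
      have "(\<lambda>j. ((1/2) ^ j) powr s) \<longlonglongrightarrow> 0"
      proof -
        have "(\<lambda>j. ((1/2) powr s) ^ j) \<longlonglongrightarrow> 0"
          using s by (intro LIMSEQ_realpow_zero) (auto simp: powr_less_one powr01_less_one)
        moreover have "((1/2) powr s) ^ j = ((1/2) ^ j) powr s" for j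
          by (simp add: powr_realpow[symmetric] powr_powr mult.commute)
        ultimately show ?thesis by simp
      qed
      then have "(\<lambda>j. ennreal (real (Suc n) * ((1/2) ^ j) powr s)) \<longlonglongrightarrow> ennreal (real (Suc n) * 0)"
        by (intro tendsto_ennrealI tendsto_intros)
      then have "emeasure unit_uniform D \<le> ennreal (real (Suc n) * 0)"
        using le True by (intro tendsto_lowerbound[where F = sequentially]) auto
      then show ?thesis by simp
    next
      case False
      then have "0 < diameter X" using diameter_ge_0[OF X(1)] by simp
      then obtain j where j: "diameter X \<le> (1/2) ^ j" "(1/2) ^ j < 2 * diameter X"
        using dyadic_scale X(2) by blast
      have "((1/2) ^ j) powr s \<le> (2 * diameter X) powr s" using j s by (intro powr_mono2) auto
      then have "real (Suc n) * ((1/2) ^ j) powr s \<le> K * diameter X powr s"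
        by (simp only: K_def powr_mult mult.assoc) (intro mult_left_mono, auto)
      then show ?thesis by (rule order_trans[OF le[OF j(1)] ennreal_leI])
    qed
    also have "\<dots> = ennreal K * diameter_power s X"
      using u(2) s K by (auto simp: diameter_power_def ennreal_mult)
    finally show ?thesis using D sub by blast
  qed
  have "hausdorff_premeasure s 1 (restricted_sums y) \<le> hausdorff_measure s (restricted_sums y)"
    unfolding hausdorff_measure_def by (intro SUP_upper) auto
  also have "\<dots> < ennreal (b / K)" using zero b K by simp
  finally obtain X :: "nat \<Rightarrow> real set" where X: "restricted_sums y \<subseteq> (\<Union>i. X i)"
    "\<And>i. bounded (X i)" "\<And>i. diameter (X i) \<le> 1" and small: "(\<Sum>i. diameter_power s (X i)) < ennreal (b / K)"
    unfolding hausdorff_premeasure_def INF_less_iff by blast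
  obtain D where D: "\<And>i. D i \<in> sets borel" "\<And>i. {u \<in> B. ?\<pi> u \<in> X i} \<subseteq> D i"
    "\<And>i. emeasure unit_uniform (D i) \<le> ennreal K * diameter_power s (X i)"
    using mass[OF X(2,3)] by metis
  have "B \<subseteq> (\<Union>i. D i)"
    using golden_projection_in_restricted_sums[OF y \<delta>] X(1) D(2) by blast
  then have "ennreal b \<le> emeasure unit_uniform (\<Union>i. D i)"
    unfolding b(1)[symmetric] using D(1) by (intro emeasure_mono) auto
  also have "\<dots> \<le> (\<Sum>i. emeasure unit_uniform (D i))"
    using D(1) by (intro emeasure_subadditive_countably) auto
  also have "\<dots> \<le> (\<Sum>i. ennreal K * diameter_power s (X i))"
    by (intro suminf_le D(3)) auto
  also have "\<dots> = ennreal K * (\<Sum>i. diameter_power s (X i))" by simp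
  also have "\<dots> < ennreal K * ennreal (b / K)"
    using small K by (intro ennreal_mult_strict_left_mono) auto
  also have "\<dots> = ennreal b" using K b by (simp add: ennreal_mult[symmetric])
  finally show False by simp
qed

section \<open>Positive Lebesgue measure\<close>

text \<open>
  Take a grid of mesh \<open>r = 2\<^sup>-\<^sup>j\<close> so fine that every cell meeting the set lies in \<open>V\<close>. If \<open>p\<^sub>m\<close> are
  the masses of these cells, then \<open>\<Sum> p\<^sub>m = 1\<close> and \<open>\<Sum> p\<^sub>m\<^sup>2\<close> is at most the correlation, hence at most
  \<open>K r\<close>. By Cauchy-Schwarz there are at least \<open>1 / (K r)\<close> cells, of total length at least \<open>1 / K\<close>.
\<close>
lemma open_superset_measure_ge:
  assumes y: "y \<in> regular_ratios \<delta> \<eta> C" and \<delta>: "0 < \<delta>" "\<delta> < 1"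
    and K: "0 < K" and freq: "\<exists>\<^sub>F j in sequentially. correlation y ((1/2) ^ j) \<le> ennreal (K * (1/2) ^ j)"
    and V: "open V" "restricted_sums y \<subseteq> V"
  shows "ennreal (1 / K) \<le> emeasure lborel V"
proof -
  let ?S = "restricted_sums y" and ?\<pi> = "golden_projection y"
  interpret U: prob_space unit_uniform by (rule prob_space_unit_uniform)
  have S: "compact ?S" by (rule compact_restricted_sums[OF y \<delta>])
  obtain e where e: "0 < e" "(\<Union>x\<in>?S. ball x e) \<subseteq> V"
    using compact_subset_open_imp_ball_epsilon_subset[OF S V] by blast
  have "(\<lambda>j. (1/2::real) ^ j) \<longlonglongrightarrow> 0" by (intro LIMSEQ_realpow_zero) auto
  then have "\<forall>\<^sub>F j in sequentially. (1/2) ^ j < e" using e(1) by (intro order_tendstoD) auto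
  then have "\<exists>\<^sub>F j in sequentially. correlation y ((1/2) ^ j) \<le> ennreal (K * (1/2) ^ j) \<and> (1/2) ^ j < e"
    by (rule frequently_eventually_frequently[OF freq])
  then obtain j where j: "correlation y ((1/2) ^ j) \<le> ennreal (K * (1/2) ^ j)" "(1/2) ^ j < e"
    by (auto dest: frequently_ex)
  define r :: real where "r = (1/2) ^ j"
  have r: "0 < r" "r < e" and cor: "correlation y r \<le> ennreal (K * r)" using j by (auto simp: r_def)
  define I where "I m = {x. \<lfloor>x / r\<rfloor> = m}" for m :: int
  have I_eq: "I m = {of_int m * r..<of_int m * r + r}" for m
    using r by (auto simp: I_def floor_eq_iff field_simps)
  define F where "F = (\<lambda>x. \<lfloor>x / r\<rfloor>) ` ?S"
  obtain b where b: "\<And>x. x \<in> ?S \<Longrightarrow> \<bar>x\<bar> \<le> b"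
    using compact_imp_bounded[OF S] by (auto simp: bounded_iff)
  have fin: "finite F"
  proof (rule finite_subset)
    show "F \<subseteq> {\<lfloor>- b / r\<rfloor>..\<lfloor>b / r\<rfloor>}"
    proof
      fix m assume "m \<in> F"
      then obtain x where "x \<in> ?S" and m: "m = \<lfloor>x / r\<rfloor>" by (auto simp: F_def)
      then have "- b \<le> x" "x \<le> b" using b[of x] by auto
      then have "- b / r \<le> x / r" "x / r \<le> b / r" using r by (intro divide_right_mono; simp)+
      then show "m \<in> {\<lfloor>- b / r\<rfloor>..\<lfloor>b / r\<rfloor>}" unfolding m by (simp only: atLeastAtMost_iff floor_mono)
    qed
  qed simp
  define p where "p m = measure unit_uniform (?\<pi> -` I m)" for m
  have I_sets: "I m \<in> sets borel" for m unfolding I_eq by simp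
  have pre: "?\<pi> -` I m \<in> sets unit_uniform" for m
    using measurable_sets[OF golden_projection_measurable_unit I_sets] by simp
  have disj: "disjoint_family_on (\<lambda>m. ?\<pi> -` I m) F"
    by (auto simp: disjoint_family_on_def I_def)
  have "(\<Sum>m\<in>F. p m) = measure unit_uniform (\<Union>m\<in>F. ?\<pi> -` I m)"
    unfolding p_def using pre by (intro U.finite_measure_finite_Union[symmetric] fin disj) auto
  also have "(\<Union>m\<in>F. ?\<pi> -` I m) = space unit_uniform"
    using golden_projection_in_restricted_sums[OF y \<delta>] by (auto simp: I_def F_def)
  finally have sum1: "(\<Sum>m\<in>F. p m) = 1" by (simp only: U.prob_space)
  have "ennreal (\<Sum>m\<in>F. (p m)\<^sup>2) = (\<Sum>m\<in>F. emeasure (unit_uniform \<Otimes>\<^sub>M unit_uniform) (?\<pi> -` I m \<times> ?\<pi> -` I m))"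
  proof -
    have "emeasure (unit_uniform \<Otimes>\<^sub>M unit_uniform) (?\<pi> -` I m \<times> ?\<pi> -` I m) = ennreal ((p m)\<^sup>2)" for m
      unfolding U.emeasure_pair_measure_Times[OF pre pre] U.emeasure_eq_measure p_def
      by (subst ennreal_mult[symmetric]) (auto simp: power2_eq_square)
    then show ?thesis by simp
  qed
  also have "\<dots> = emeasure (unit_uniform \<Otimes>\<^sub>M unit_uniform) (\<Union>m\<in>F. ?\<pi> -` I m \<times> ?\<pi> -` I m)"
    using disj pre by (intro sum_emeasure fin) (auto simp: disjoint_family_on_def)
  also have "\<dots> \<le> correlation y r"
    unfolding correlation_def
  proof (rule emeasure_mono)
    show "(\<Union>m\<in>F. ?\<pi> -` I m \<times> ?\<pi> -` I m) \<subseteq> {p. \<bar>?\<pi> (fst p) - ?\<pi> (snd p)\<bar> \<le> r}"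
      unfolding I_eq by auto
    have "Measurable.pred (unit_uniform \<Otimes>\<^sub>M unit_uniform) (\<lambda>p. \<bar>?\<pi> (fst p) - ?\<pi> (snd p)\<bar> \<le> r)" by measurable
    then show "{p. \<bar>?\<pi> (fst p) - ?\<pi> (snd p)\<bar> \<le> r} \<in> sets (unit_uniform \<Otimes>\<^sub>M unit_uniform)"
      by (simp add: pred_def space_pair_measure)
  qed
  also note cor
  finally have sq: "(\<Sum>m\<in>F. (p m)\<^sup>2) \<le> K * r" using K r by (simp add: ennreal_le_iff)
  have "1 = (\<Sum>m\<in>F. 1 * p m)\<^sup>2" using sum1 by simp
  also have "\<dots> \<le> (\<Sum>m\<in>F. 1\<^sup>2) * (\<Sum>m\<in>F. (p m)\<^sup>2)" by (rule Cauchy_Schwarz_ineq_sum)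
  also have "\<dots> \<le> real (card F) * (K * r)" using sq by (simp add: mult_left_mono)
  finally have "1 / K \<le> real (card F) * r" using K by (simp add: field_simps)
  then have "ennreal (1 / K) \<le> ennreal (real (card F) * r)" by (rule ennreal_leI)
  also have "\<dots> = (\<Sum>m\<in>F. emeasure lborel (I m))"
    unfolding I_eq using r by (simp add: ennreal_of_nat_eq_real_of_nat ennreal_mult')
  also have "\<dots> = emeasure lborel (\<Union>m\<in>F. I m)"
    using I_sets by (intro sum_emeasure fin) (auto simp: disjoint_family_on_def I_def)
  also have "\<dots> \<le> emeasure lborel V"
  proof (rule emeasure_mono)
    show "(\<Union>m\<in>F. I m) \<subseteq> V"
    proof safe
      fix m x assume "m \<in> F" "x \<in> I m"
      then obtain z where z: "z \<in> ?S" "z \<in> I m" by (auto simp: F_def I_def)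
      then have "\<bar>z - x\<bar> < r" using \<open>x \<in> I m\<close> unfolding I_eq by auto
      then have "x \<in> ball z e" using r by (simp add: dist_real_def)
      then show "x \<in> V" using z e(2) by blast
    qed
    show "V \<in> sets lborel" using V(1) by simp
  qed
  finally show ?thesis .
qed

lemma restricted_sums_pos_measure:
  assumes y: "y \<in> regular_ratios \<delta> \<eta> C" and \<delta>: "0 < \<delta>" "\<delta> < 1"
    and K: "0 < K" and freq: "\<exists>\<^sub>F j in sequentially. correlation y ((1/2) ^ j) \<le> ennreal (K * (1/2) ^ j)"
  shows "0 < emeasure lebesgue (restricted_sums y)"
proof -
  let ?S = "restricted_sums y"
  have S: "?S \<in> sets borel"
    using compact_restricted_sums[OF y \<delta>] by (intro borel_closed compact_imp_closed)
  have "emeasure lborel ?S \<noteq> 0"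
  proof
    assume zero: "emeasure lborel ?S = 0"
    obtain V where V: "open V" "?S \<subseteq> V" "emeasure lborel (V - ?S) < ennreal (1 / K)"
      using outer_regular_lborel[OF S, of "1 / K"] K by auto
    have "ennreal (1 / K) \<le> emeasure lborel V"
      by (rule open_superset_measure_ge[OF y \<delta> K freq V(1,2)])
    also have "\<dots> = emeasure lborel (V - ?S)"
      using S zero V(1) by (intro emeasure_Diff_null_set[symmetric]) (auto simp: null_sets_def)
    finally show False using V(3) by simp
  qed
  then show ?thesis using S by (simp add: zero_less_iff_neq_zero)
qed

text \<open>
  Fatou's lemma for the normalised correlations \<open>2\<^sup>j correlation y 2\<^sup>-\<^sup>j\<close>, whose expectations are
  bounded.
\<close>
lemma AE_correlation_frequently_linear:
  assumes "0 < \<theta>" and \<delta>: "0 < \<delta>" "\<delta> < 1" and "0 < \<eta>" "\<eta> < 1" "0 < C" and \<eta>: "1 < \<eta> * golden"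
  shows "AE y in ratio_space \<theta>. y \<in> regular_ratios \<delta> \<eta> C \<longrightarrow>
    (\<exists>K>0. \<exists>\<^sub>F j in sequentially. correlation y ((1/2) ^ j) \<le> ennreal (K * (1/2) ^ j))"
proof -
  obtain K where K: "0 \<le> K" "\<And>r. 0 < r \<Longrightarrow>
    (\<integral>\<^sup>+y. indicator (regular_ratios \<delta> \<eta> C) y * correlation y r \<partial>ratio_space \<theta>) \<le> ennreal (K * r powr 1)"
    using expected_correlation_bound[OF assms(1-6), of 1] assms by auto
  let ?f = "\<lambda>j y. ennreal (2 ^ j) * (indicator (regular_ratios \<delta> \<eta> C) y * correlation y ((1/2) ^ j))"
  have "(\<integral>\<^sup>+y. ?f j y \<partial>ratio_space \<theta>) \<le> ennreal K" for j
  proof -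
    have "(\<integral>\<^sup>+y. ?f j y \<partial>ratio_space \<theta>)
       = ennreal (2 ^ j) * (\<integral>\<^sup>+y. indicator (regular_ratios \<delta> \<eta> C) y * correlation y ((1/2) ^ j) \<partial>ratio_space \<theta>)"
      by (rule nn_integral_cmult) measurable
    also have "\<dots> \<le> ennreal (2 ^ j) * ennreal (K * ((1/2) ^ j) powr 1)"
      by (intro mult_left_mono K) auto
    also have "\<dots> = ennreal K"
      using K(1) by (subst ennreal_mult[symmetric]) (auto simp: power_one_over)
    finally show ?thesis .
  qed
  then have "liminf (\<lambda>j. \<integral>\<^sup>+y. ?f j y \<partial>ratio_space \<theta>) \<le> ennreal K"
    by (intro Liminf_le always_eventually allI) auto
  moreover have "(\<integral>\<^sup>+y. liminf (\<lambda>j. ?f j y) \<partial>ratio_space \<theta>) \<le> liminf (\<lambda>j. \<integral>\<^sup>+y. ?f j y \<partial>ratio_space \<theta>)"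
    by (rule nn_integral_liminf) measurable
  ultimately have "(\<integral>\<^sup>+y. liminf (\<lambda>j. ?f j y) \<partial>ratio_space \<theta>) \<noteq> \<infinity>"
    by (auto simp: top_unique)
  then have "AE y in ratio_space \<theta>. liminf (\<lambda>j. ?f j y) \<noteq> \<infinity>"
    by (intro nn_integral_PInf_AE) measurable
  then show ?thesis
  proof eventually_elim
    case liminf: (elim y)
    show ?case
    proof
      assume reg: "y \<in> regular_ratios \<delta> \<eta> C"
      obtain x where x: "liminf (\<lambda>j. ?f j y) = ennreal x" "0 \<le> x"
        using liminf by (cases "liminf (\<lambda>j. ?f j y)") auto
      have "\<exists>\<^sub>F j in sequentially. correlation y ((1/2) ^ j) \<le> ennreal ((x + 1) * (1/2) ^ j)"
      proof (rule ccontr)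
        assume "\<not> (\<exists>\<^sub>F j in sequentially. correlation y ((1/2) ^ j) \<le> ennreal ((x + 1) * (1/2) ^ j))"
        then have "\<forall>\<^sub>F j in sequentially. ennreal ((x + 1) * (1/2) ^ j) \<le> correlation y ((1/2) ^ j)"
          unfolding not_frequently by eventually_elim simp
        then have "\<forall>\<^sub>F j in sequentially. ennreal (x + 1) \<le> ?f j y"
        proof eventually_elim
          case (elim j)
          have "ennreal (x + 1) = ennreal (2 ^ j) * ennreal ((x + 1) * (1/2) ^ j)"
            using x(2) by (subst ennreal_mult[symmetric]) (auto simp: power_one_over)
          also have "\<dots> \<le> ennreal (2 ^ j) * correlation y ((1/2) ^ j)"
            using elim by (intro mult_left_mono) auto
          finally show ?case using reg by simp
        qed
        then have "ennreal (x + 1) \<le> liminf (\<lambda>j. ?f j y)" by (rule Liminf_bounded)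
        then show False using x by simp
      qed
      then show "\<exists>K>0. \<exists>\<^sub>F j in sequentially. correlation y ((1/2) ^ j) \<le> ennreal (K * (1/2) ^ j)"
        using x(2) by (intro exI[of _ "x + 1"]) auto
    qed
  qed
qed

section \<open>From growth rates to the dimension\<close>

lemma exp_ln_golden_powr: "s \<noteq> 0 \<Longrightarrow> exp (- ln golden / s) powr s = 1 / golden"
  using golden_bounds by (simp only: exp_powr_real) (simp add: exp_minus inverse_eq_divide)

text \<open>
  As \<open>\<theta> ln \<tau> > 1\<close>, there is room for a growth rate \<open>\<eta>\<close> between \<open>1 / \<tau>\<close> and \<open>exp (- 1 / \<theta>)\<close>.
\<close>
lemma AE_restricted_sums_pos_measure:
  assumes "0 < \<theta>" "1 < \<theta> * ln golden"
  shows "AE y in ratio_space \<theta>. 0 < emeasure lebesgue (restricted_sums y)"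
proof -
  have "exp (- 1 / \<theta>) < 1" using assms(1) by simp
  then obtain \<delta> where \<delta>: "exp (- 1 / \<theta>) < \<delta>" "\<delta> < 1" using dense by blast
  have "exp (- ln golden) < exp (- 1 / \<theta>)" using assms by (simp add: field_simps)
  then obtain \<eta> where \<eta>: "exp (- ln golden) < \<eta>" "\<eta> < exp (- 1 / \<theta>)" using dense by blast
  have pos: "0 < \<delta>" "0 < \<eta>" using \<delta>(1) \<eta>(1) exp_gt_zero order.strict_trans by blast+
  have "1 < \<eta> * golden" using \<eta>(1) golden_bounds by (simp add: exp_minus field_simps)
  then have "AE y in ratio_space \<theta>. \<forall>N. y \<in> regular_ratios \<delta> \<eta> (real (Suc N)) \<longrightarrow>
      (\<exists>K>0. \<exists>\<^sub>F j in sequentially. correlation y ((1/2) ^ j) \<le> ennreal (K * (1/2) ^ j))"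
    unfolding AE_all_countable using assms \<delta> \<eta> pos
    by (intro allI AE_correlation_frequently_linear) auto
  then show ?thesis using AE_regular_ratios[OF assms(1) \<delta>(1) pos(2) \<eta>(2)]
  proof eventually_elim
    case (elim y)
    then show ?case using restricted_sums_pos_measure[OF _ pos(1) \<delta>(2)] by blast
  qed
qed

text \<open>
  With an exponent \<open>s\<close> strictly between \<open>t\<close> and \<open>\<theta> ln \<tau>\<close> there is room for a growth rate \<open>\<eta>\<close> between
  \<open>\<tau>\<^sup>-\<^sup>1\<^sup>/\<^sup>s\<close> and \<open>exp (- 1 / \<theta>)\<close>.
\<close>
lemma AE_hausdorff_measure_pos:
  assumes "0 < \<theta>" "\<theta> * ln golden \<le> 1" "0 < t" "t < \<theta> * ln golden"
  shows "AE y in ratio_space \<theta>. hausdorff_measure t (restricted_sums y) \<noteq> 0"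
proof -
  have "exp (- 1 / \<theta>) < 1" using assms(1) by simp
  then obtain \<delta> where \<delta>: "exp (- 1 / \<theta>) < \<delta>" "\<delta> < 1" using dense by blast
  obtain s where s: "t < s" "s < \<theta> * ln golden" using dense assms(4) by blast
  have "exp (- ln golden / s) < exp (- 1 / \<theta>)" using assms s by (simp add: field_simps)
  then obtain \<eta> where \<eta>: "exp (- ln golden / s) < \<eta>" "\<eta> < exp (- 1 / \<theta>)" using dense by blast
  have pos: "0 < \<delta>" "0 < \<eta>" using \<delta>(1) \<eta>(1) exp_gt_zero order.strict_trans by blast+
  have "1 < \<eta> powr s * golden"
  proof -
    have "exp (- ln golden / s) powr s < \<eta> powr s" using \<eta> s assms by (intro powr_less_mono2) auto
    moreover have "exp (- ln golden / s) powr s = 1 / golden"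
      using s assms by (intro exp_ln_golden_powr) auto
    ultimately have "1 / golden < \<eta> powr s" by (simp only:)
    then show ?thesis using golden_bounds by (simp add: field_simps)
  qed
  then have "AE y in ratio_space \<theta>. \<forall>N. y \<in> regular_ratios \<delta> \<eta> (real (Suc N)) \<longrightarrow>
      (\<Sum>j. ennreal ((2 powr t) ^ j) * correlation y ((1/2) ^ j)) \<noteq> \<infinity>"
    unfolding AE_all_countable using assms \<delta> \<eta> pos s
    by (intro allI AE_correlation_series_finite[where s = s]) auto
  then show ?thesis using AE_regular_ratios[OF assms(1) \<delta>(1) pos(2) \<eta>(2)]
  proof eventually_elim
    case (elim y)
    then show ?case using hausdorff_measure_pos_of_correlation[OF _ pos(1) \<delta>(2) assms(3)] by blast
  qed
qed

text \<open>
  A decay rate \<open>\<delta>\<close> between \<open>exp (- 1 / \<theta>)\<close> and \<open>\<tau>\<^sup>-\<^sup>1\<^sup>/\<^sup>t\<close> makes the cylinder covers arbitrarily cheap.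
\<close>
lemma AE_restricted_sums_small:
  assumes "0 < \<theta>" "\<theta> * ln golden < t"
  shows "AE y in ratio_space \<theta>. hausdorff_measure t (restricted_sums y) = 0 \<and>
    (t = 1 \<longrightarrow> restricted_sums y \<in> null_sets lebesgue)"
proof -
  have "0 < \<theta> * ln golden" using assms(1) ln_golden_pos by simp
  then have t: "0 < t" using assms(2) by linarith
  have "exp (- 1 / \<theta>) < min 1 (exp (- ln golden / t))" using assms t by (simp add: field_simps)
  then obtain \<delta> where \<delta>: "exp (- 1 / \<theta>) < \<delta>" "\<delta> < min 1 (exp (- ln golden / t))" using dense by blast
  obtain \<eta> where \<eta>: "0 < \<eta>" "\<eta> < exp (- 1 / \<theta>)" using dense exp_gt_zero by blast
  have pos: "0 < \<delta>" using \<delta>(1) exp_gt_zero order.strict_trans by blast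
  have le: "\<delta> powr t * golden < 1"
  proof -
    have "\<delta> powr t < exp (- ln golden / t) powr t" using \<delta> t pos by (intro powr_less_mono2) auto
    moreover have "exp (- ln golden / t) powr t = 1 / golden"
      using t by (intro exp_ln_golden_powr) auto
    ultimately have "\<delta> powr t < 1 / golden" by (simp only:)
    then show ?thesis using golden_bounds by (simp add: field_simps)
  qed
  show ?thesis using AE_regular_ratios[OF assms(1) \<delta>(1) \<eta>]
  proof eventually_elim
    case (elim y)
    then obtain N where y: "y \<in> regular_ratios \<delta> \<eta> (real (Suc N))" by blast
    have "\<delta> < 1" using \<delta> by simp
    then show ?case
      using hausdorff_measure_restricted_sums_zero[OF y pos] restricted_sums_null_set[OF y pos] le pos t
      by auto
  qed
qed

text \<open>
  Countably many exponents decide the dimension; this is what allows the null sets of the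
  almost sure statements to be united.
\<close>
lemma hausdorff_dim_eqI:
  assumes "0 < d" and upper: "\<And>n. hausdorff_measure (d + 1 / real (Suc n)) A = 0"
    and lower: "\<And>n. 0 < d - 1 / real (Suc n) \<Longrightarrow> hausdorff_measure (d - 1 / real (Suc n)) A \<noteq> 0"
  shows "hausdorff_dim A = ereal d"
proof (rule antisym)
  show "hausdorff_dim A \<le> ereal d"
  proof (rule ereal_le_epsilon2)
    fix e :: real assume "0 < e"
    then obtain n where "1 / real (Suc n) < e" by (rule nat_approx_posE)
    moreover have "hausdorff_dim A \<le> ereal (d + 1 / real (Suc n))"
      unfolding hausdorff_dim_def using upper assms(1) by (intro INF_lower) auto
    ultimately show "hausdorff_dim A \<le> ereal d + ereal e" by (elim order_trans) auto
  qed
  show "ereal d \<le> hausdorff_dim A"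
    unfolding hausdorff_dim_def
  proof (rule INF_greatest, rule ccontr)
    fix s assume s: "s \<in> {s. 0 \<le> s \<and> hausdorff_measure s A = 0}" and "\<not> ereal d \<le> ereal s"
    then have "0 < d - s" by simp
    then obtain n where n: "1 / real (Suc n) < d - s" by (rule nat_approx_posE)
    have "hausdorff_measure (d - 1 / real (Suc n)) A = 0"
      by (rule hausdorff_measure_mono_exponent[of s]) (use s n in \<open>simp_all del: of_nat_Suc\<close>)
    moreover have "0 < d - 1 / real (Suc n)" using s n by auto
    ultimately show False using lower by blast
  qed
qed

theorem proposition1p3:
  fixes \<theta> :: real and M :: "'a measure" and Y :: "nat \<Rightarrow> 'a \<Rightarrow> real"
  assumes "\<theta> > 0"
    and "prob_space M"
    and "prob_space.indep_vars M (\<lambda>_. borel) Y UNIV"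
    and "\<And>i. distr M borel (Y i) = power_uniform_law \<theta>"
  shows "(\<theta> > 1 / ln golden \<longrightarrow>
            (AE y in distr M (Pi\<^sub>M UNIV (\<lambda>_. borel)) (\<lambda>\<omega> i. Y i \<omega>).
               emeasure lebesgue (restricted_sums y) > 0)) \<and>
         (\<theta> < 1 / ln golden \<longrightarrow>
            (AE y in distr M (Pi\<^sub>M UNIV (\<lambda>_. borel)) (\<lambda>\<omega> i. Y i \<omega>).
               restricted_sums y \<in> null_sets lebesgue \<and>
               hausdorff_dim (restricted_sums y) = ereal (\<theta> * ln golden)))"
  unfolding distr_indep_eq_ratio_space[OF assms(2-4)]
proof (intro conjI impI)
  assume "\<theta> > 1 / ln golden"
  then show "AE y in ratio_space \<theta>. emeasure lebesgue (restricted_sums y) > 0"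
    using assms(1) ln_golden_pos by (intro AE_restricted_sums_pos_measure) (auto simp: field_simps)
next
  assume "\<theta> < 1 / ln golden"
  then have lt: "\<theta> * ln golden < 1" using ln_golden_pos by (simp add: field_simps)
  have pos: "0 < \<theta> * ln golden" using assms(1) ln_golden_pos by simp
  let ?d = "\<theta> * ln golden"
  have "AE y in ratio_space \<theta>. \<forall>n. hausdorff_measure (?d + 1 / real (Suc n)) (restricted_sums y) = 0"
    unfolding AE_all_countable
  proof
    fix n
    show "AE y in ratio_space \<theta>. hausdorff_measure (?d + 1 / real (Suc n)) (restricted_sums y) = 0"
      using AE_restricted_sums_small[OF assms(1), of "?d + 1 / real (Suc n)"] by auto
  qed
  moreover have "AE y in ratio_space \<theta>. \<forall>n. 0 < ?d - 1 / real (Suc n) \<longrightarrow>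
      hausdorff_measure (?d - 1 / real (Suc n)) (restricted_sums y) \<noteq> 0"
    unfolding AE_all_countable
  proof
    fix n
    show "AE y in ratio_space \<theta>. 0 < ?d - 1 / real (Suc n) \<longrightarrow>
        hausdorff_measure (?d - 1 / real (Suc n)) (restricted_sums y) \<noteq> 0"
      using AE_hausdorff_measure_pos[OF assms(1), of "?d - 1 / real (Suc n)"] lt
      by (cases "0 < ?d - 1 / real (Suc n)") auto
  qed
  moreover have "AE y in ratio_space \<theta>. restricted_sums y \<in> null_sets lebesgue"
    using AE_restricted_sums_small[OF assms(1) lt] by auto
  ultimately show "AE y in ratio_space \<theta>. restricted_sums y \<in> null_sets lebesgue \<and>
      hausdorff_dim (restricted_sums y) = ereal ?d"
  proof eventually_elim
    case (elim y)
    then show ?case using hausdorff_dim_eqI[OF pos, of "restricted_sums y"] by blast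
  qed
qed

end
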